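(* Let $D$ be a finitely connected domain with $\infty\in D$ and $0\notin D$, and let $n$ be the number of connected components of $\hat{\mathbb{C}}\setminus D$. From a name of $D$, a name of $\partial D$, and $n$, one can uniformly compute: - a labeling $D_{0,1},\dots,D_{0,n}$ of the connected components of $\hat{\mathbb{C}}\setminus D$; - names of the open sets $\hat{\mathbb{C}}\setminus D_{0,1},\dots,\hat{\mathbb{C}}\setminus D_{0,n}$; - names of the closed sets $\partial D_{0,1},\dots,\partial D_{0,n}$.
   Context: Computability is in the sense of Type-Two Effectivity. $\hat{\mathbb{C}}=\mathbb{C}\cup\{\infty\}$, and $D_r(z)$ is the open disk of radius $r$ centered at $z$. The basic open sets are the open rectangles whose vertices have rational coordinates, together with the sets $\hat{\mathbb{C}}\setminus\overline{D_r(0)}$ with $r$ rational. Names: - A name of a point $z\in\hat{\mathbb{C}}$ is a list of all basic open sets containing $z$. - A name of an open set $U$ is a list of all basic open sets whose closures lie in $U$. - A name of a closed set $C$ is a list of all basic open sets meeting $C$. - "Uniformly computable" means a single Turing machine with one-way output tape, given names of the data, writes names of the outputs. A domain is an open connected subset of $\hat{\mathbb{C}}$. It is finitely connected if its complement has finitely many connected components. *)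

theory Defs
  imports "HOL-Analysis.Analysis" "HOL-Library.Nat_Bijection"
begin

datatype recf = Zero | Succ | Proj nat | Comp recf "recf list" | Prim recf recf | Mn recf

inductive eval :: "recf \<Rightarrow> nat list \<Rightarrow> nat \<Rightarrow> bool" where
  eval_Zero: "eval Zero xs 0"
| eval_Succ: "eval Succ (x # xs) (Suc x)"
| eval_Proj: "i < length xs \<Longrightarrow> eval (Proj i) xs (xs ! i)"
| eval_Comp: "length ys = length gs \<Longrightarrow> (\<forall>i<length gs. eval (gs ! i) xs (ys ! i))
               \<Longrightarrow> eval f ys z \<Longrightarrow> eval (Comp f gs) xs z"
| eval_Prim0: "eval f xs z \<Longrightarrow> eval (Prim f g) (0 # xs) z"
| eval_PrimS: "eval (Prim f g) (n # xs) y \<Longrightarrow> eval g (y # n # xs) z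
               \<Longrightarrow> eval (Prim f g) (Suc n # xs) z"
| eval_Mn: "eval f (n # xs) 0 \<Longrightarrow> (\<forall>m<n. \<exists>y. eval f (m # xs) y \<and> 0 < y)
               \<Longrightarrow> eval (Mn f) xs n"

definition total_recursive :: "(nat \<Rightarrow> nat) \<Rightarrow> bool" where
  "total_recursive h \<longleftrightarrow> (\<exists>c. \<forall>x. eval c [x] (h x))"

text \<open>A machine is given by a total recursive function h mapping (the code of) the
  prefix of length k of the input sequence to (the code of) the finite word written on
  the one-way output tape after reading that prefix.  The machine computes output y on
  input x if every such word is a prefix of y and the words become arbitrarily long.\<close>

definition prefix_code :: "(nat \<Rightarrow> nat) \<Rightarrow> nat \<Rightarrow> nat" where
  "prefix_code x k = list_encode (map x [0..<k])"

definition tte_computes :: "(nat \<Rightarrow> nat) \<Rightarrow> (nat \<Rightarrow> nat) \<Rightarrow> (nat \<Rightarrow> nat) \<Rightarrow> bool" where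
  "tte_computes h x y \<longleftrightarrow>
     (\<forall>k. let w = list_decode (h (prefix_code x k)) in w = map y [0..<length w]) \<and>
     (\<forall>m. \<exists>k. m \<le> length (list_decode (h (prefix_code x k))))"

text \<open>Points: Some z for z in C, None for infinity.\<close>

definition riemann_open :: "complex option set \<Rightarrow> bool" where
  "riemann_open U \<longleftrightarrow> open (Some -` U) \<and>
     (None \<in> U \<longrightarrow> (\<exists>r. \<forall>z. r < norm z \<longrightarrow> Some z \<in> U))"

lemma istopology_riemann_open: "istopology riemann_open"
proof -
  have 1: "riemann_open (S \<inter> T)" if S: "riemann_open S" and T: "riemann_open T" for S T
  proof -
    have "open (Some -` (S \<inter> T))" using S T by (simp add: riemann_open_def vimage_Int open_Int)
    moreover have "\<exists>r. \<forall>z. r < norm z \<longrightarrow> Some z \<in> S \<inter> T" if "None \<in> S \<inter> T"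
    proof -
      obtain r1 r2 where "\<forall>z. r1 < norm z \<longrightarrow> Some z \<in> S" "\<forall>z. r2 < norm z \<longrightarrow> Some z \<in> T"
        using S T \<open>None \<in> S \<inter> T\<close> unfolding riemann_open_def by blast
      then show ?thesis by (intro exI[of _ "max r1 r2"]) auto
    qed
    ultimately show ?thesis by (simp add: riemann_open_def)
  qed
  have 2: "riemann_open (\<Union>K)" if K: "\<forall>S\<in>K. riemann_open S" for K
  proof -
    have "open (Some -` \<Union>K)" using K by (auto simp: riemann_open_def vimage_Union intro!: open_Union)
    moreover have "None \<in> \<Union>K \<longrightarrow> (\<exists>r. \<forall>z. r < norm z \<longrightarrow> Some z \<in> \<Union>K)"
      using K unfolding riemann_open_def by blast
    ultimately show ?thesis by (simp add: riemann_open_def)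
  qed
  show ?thesis unfolding istopology_def using 1 2 by blast
qed

definition riemann_topology :: "complex option topology" where
  "riemann_topology = topology riemann_open"

lemma openin_riemann_topology: "openin riemann_topology U \<longleftrightarrow> riemann_open U"
  unfolding riemann_topology_def using istopology_riemann_open
  by (simp add: topology_inverse')

datatype basic = Rect rat rat rat rat | Ext rat

fun basic_set :: "basic \<Rightarrow> complex option set" where
  "basic_set (Rect a b c d) =
     {Some z | z. of_rat a < Re z \<and> Re z < of_rat b \<and> of_rat c < Im z \<and> Im z < of_rat d}"
| "basic_set (Ext r) = insert None {Some z | z. of_rat r < norm z}"

definition rat_of_code :: "nat \<Rightarrow> rat" where
  "rat_of_code n = (case prod_decode n of (a, b) \<Rightarrow> of_int (int_decode a) / of_nat (Suc b))"

definition basic_of_code :: "nat \<Rightarrow> basic" where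
  "basic_of_code n = (case sum_decode n of
      Inl m \<Rightarrow> (case prod_decode m of (m1, m') \<Rightarrow>
               (case prod_decode m' of (m2, m'') \<Rightarrow>
               (case prod_decode m'' of (m3, m4) \<Rightarrow>
                  Rect (rat_of_code m1) (rat_of_code m2) (rat_of_code m3) (rat_of_code m4))))
    | Inr m \<Rightarrow> Ext (rat_of_code m))"

definition bset :: "nat \<Rightarrow> complex option set" where
  "bset k = basic_set (basic_of_code k)"

text \<open>A sequence p lists the set of codes {k | p i = Suc k for some i}; the value 0 is a
  blank (so that empty or finite lists can be written).\<close>

definition listed :: "(nat \<Rightarrow> nat) \<Rightarrow> nat set" where
  "listed p = {k. \<exists>i. p i = Suc k}"

definition open_name :: "complex option set \<Rightarrow> (nat \<Rightarrow> nat) \<Rightarrow> bool" where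
  "open_name U p \<longleftrightarrow> listed p = {k. riemann_topology closure_of bset k \<subseteq> U}"

definition closed_name :: "complex option set \<Rightarrow> (nat \<Rightarrow> nat) \<Rightarrow> bool" where
  "closed_name C p \<longleftrightarrow> listed p = {k. bset k \<inter> C \<noteq> {}}"

definition input3 :: "(nat \<Rightarrow> nat) \<Rightarrow> (nat \<Rightarrow> nat) \<Rightarrow> nat \<Rightarrow> nat \<Rightarrow> nat" where
  "input3 p q n i = prod_encode (p i, prod_encode (q i, n))"

definition out_component :: "(nat \<Rightarrow> nat) \<Rightarrow> nat \<Rightarrow> nat \<Rightarrow> nat" where
  "out_component y j i = y (prod_encode (j, i))"

definition sphere_domain :: "complex option set \<Rightarrow> bool" where
  "sphere_domain D \<longleftrightarrow> openin riemann_topology D \<and> connectedin riemann_topology D \<and> D \<noteq> {}"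

definition complement_components :: "complex option set \<Rightarrow> complex option set set" where
  "complement_components D = connected_components_of (subtopology riemann_topology (- D))"

end

theory Submission
  imports Defs
begin

text \<open>Write \<open>E\<close> for the compact planar set complementary to the domain.  A certificate is a fine grid
  on a square containing \<open>E\<close> together with a labelling of its closed cells, such that cells labelled
  0 are listed as lying in the domain, adjacent cells with nonzero labels have the same label, and for
  each label \<open>1, \<dots>, n\<close> some cell with this label has a neighbourhood of adjacent cells listed as
  meeting the boundary.  The unions of the cells with a given nonzero label then cut \<open>E\<close> into \<open>n\<close>
  nonempty pairwise disjoint closed pieces; as \<open>E\<close> has exactly \<open>n\<close> components, these pieces are the
  components.  Certificates exist because the finitely many components have positive distance from
  each other, and they can be found by exhaustive search.

  Once a certificate is fixed, both output lists are recursively enumerable by refining the grid: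
  the closure of a basic set misses a piece iff on some refinement every subcell with that label is
  listed as lying in the domain or is disjoint from the closure; a basic set meets the boundary of
  a piece iff it contains a small block around a subcell with that label which is listed as
  meeting the boundary.\<close>

section \<open>Total recursive functions\<close>

text \<open>Names carry positive information only. The name of the domain can confirm that a cell
  avoids \<open>E\<close> but never that it meets \<open>E\<close>; that a piece is nonempty must
  come from the name of the boundary. Nothing listed ever shows that a piece is connected: the
  number \<open>n\<close> stands in for such a proof, because \<open>n\<close> nonempty clopen
  pieces of a set with \<open>n\<close> components cannot be split further. Points of the boundary
  are confirmed in open sets only, and open cells would miss the grid lines, so cells are enlarged
  to open blocks. A point of \<open>E\<close> found in a block may lie in a neighbouring cell; the
  rule that adjacent nonzero labels agree still puts it into the right piece. Output cannot be
  revoked, so all prefixes of an input must lead to the same labelling. The code of a certificate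
  bounds the length of input that it consults. Hence the least valid code is settled once the prefix
  is longer than it, and nothing is written before.\<close>

definition list_recursive :: "nat \<Rightarrow> (nat list \<Rightarrow> nat) \<Rightarrow> bool" where
  "list_recursive n f \<longleftrightarrow> (\<exists>c. \<forall>xs. length xs = n \<longrightarrow> eval c xs (f xs))"

lemma total_recursive_iff: "total_recursive f \<longleftrightarrow> list_recursive 1 (\<lambda>xs. f (xs ! 0))"
proof
  assume "total_recursive f"
  then obtain c where c: "\<And>x. eval c [x] (f x)" by (auto simp: total_recursive_def)
  have "eval c xs (f (xs ! 0))" if "length xs = 1" for xs
    using that c by (cases xs) auto
  then show "list_recursive 1 (\<lambda>xs. f (xs ! 0))" by (auto simp: list_recursive_def)
next
  assume "list_recursive 1 (\<lambda>xs. f (xs ! 0))"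
  then obtain c where c: "\<And>xs. length xs = 1 \<Longrightarrow> eval c xs (f (xs ! 0))"
    by (auto simp: list_recursive_def)
  have "eval c [x] (f x)" for x using c[of "[x]"] by simp
  then show "total_recursive f" by (auto simp: total_recursive_def)
qed

lemma list_recursive_nth: "i < n \<Longrightarrow> list_recursive n (\<lambda>xs. xs ! i)"
  unfolding list_recursive_def by (intro exI[of _ "Proj i"]) (auto intro: eval_Proj)

lemma list_recursive_zero: "list_recursive n (\<lambda>xs. 0)"
  unfolding list_recursive_def by (intro exI[of _ Zero]) (auto intro: eval_Zero)

lemma list_recursive_comp1:
  assumes "list_recursive 1 f" "list_recursive n g"
  shows "list_recursive n (\<lambda>xs. f [g xs])"
proof -
  obtain c d where c: "\<And>xs. length xs = 1 \<Longrightarrow> eval c xs (f xs)"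
    and d: "\<And>xs. length xs = n \<Longrightarrow> eval d xs (g xs)"
    using assms by (auto simp: list_recursive_def)
  have "eval (Comp c [d]) xs (f [g xs])" if "length xs = n" for xs
    by (rule eval_Comp[of "[g xs]"]) (auto intro: c d that)
  then show ?thesis by (auto simp: list_recursive_def)
qed

lemma list_recursive_comp2:
  assumes "list_recursive 2 f" "list_recursive n g" "list_recursive n g'"
  shows "list_recursive n (\<lambda>xs. f [g xs, g' xs])"
proof -
  obtain c d d' where c: "\<And>xs. length xs = 2 \<Longrightarrow> eval c xs (f xs)"
    and d: "\<And>xs. length xs = n \<Longrightarrow> eval d xs (g xs)"
    and d': "\<And>xs. length xs = n \<Longrightarrow> eval d' xs (g' xs)"
    using assms by (auto simp: list_recursive_def)
  have "eval (Comp c [d, d']) xs (f [g xs, g' xs])" if "length xs = n" for xs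
    by (rule eval_Comp[of "[g xs, g' xs]"]) (auto intro: c d d' that simp: less_Suc_eq)
  then show ?thesis by (auto simp: list_recursive_def)
qed

lemma list_recursive_Suc: "list_recursive n f \<Longrightarrow> list_recursive n (\<lambda>xs. Suc (f xs))"
proof -
  have "eval Succ xs (Suc (hd xs))" if "length xs = 1" for xs :: "nat list"
    using that by (cases xs) (auto intro: eval_Succ)
  then have "list_recursive 1 (\<lambda>xs. Suc (hd xs))" by (auto simp: list_recursive_def)
  then show "list_recursive n f \<Longrightarrow> ?thesis" using list_recursive_comp1 by fastforce
qed

text \<open>\<open>Prim\<close> recurses on the head of the argument list and passes to its step
  function the previous value, then the counter, then the parameters; the right-hand side is this
  recursion in terms of \<open>rec_nat\<close>.\<close>

lemma list_recursive_rec: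
  assumes "list_recursive n f" "list_recursive (Suc (Suc n)) g"
  shows "list_recursive (Suc n) (\<lambda>xs. rec_nat (f (tl xs)) (\<lambda>m y. g (y # m # tl xs)) (hd xs))"
proof -
  obtain c d where c: "\<And>xs. length xs = n \<Longrightarrow> eval c xs (f xs)"
    and d: "\<And>xs. length xs = Suc (Suc n) \<Longrightarrow> eval d xs (g xs)"
    using assms by (auto simp: list_recursive_def)
  have *: "eval (Prim c d) (m # ys) (rec_nat (f ys) (\<lambda>m y. g (y # m # ys)) m)"
    if "length ys = n" for m ys
    by (induction m) (auto intro!: eval_Prim0 c that eval_PrimS d)
  have "eval (Prim c d) xs (rec_nat (f (tl xs)) (\<lambda>m y. g (y # m # tl xs)) (hd xs))"
    if "length xs = Suc n" for xs
    using *[of "tl xs" "hd xs"] that by (cases xs) auto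
  then show ?thesis by (auto simp: list_recursive_def)
qed

lemma list_recursive_cong:
  "list_recursive n f \<Longrightarrow> (\<And>xs. length xs = n \<Longrightarrow> f xs = g xs) \<Longrightarrow> list_recursive n g"
  unfolding list_recursive_def by (metis (no_types, lifting))

lemma list_recursive_rec1:
  assumes "list_recursive 2 (\<lambda>xs. g (xs ! 0) (xs ! 1))"
  shows "list_recursive 1 (\<lambda>xs. rec_nat a (\<lambda>m y. g y m) (xs ! 0))"
proof -
  have "list_recursive 0 (\<lambda>xs. a)"
    by (induction a) (auto intro: list_recursive_zero list_recursive_Suc)
  from list_recursive_rec[OF this, of "\<lambda>xs. g (xs ! 0) (xs ! 1)"] assms
  have "list_recursive 1 (\<lambda>xs. rec_nat a (\<lambda>m y. g y m) (hd xs))"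
    by (simp add: numeral_2_eq_2)
  then show ?thesis
    by (rule list_recursive_cong) (auto simp: length_Suc_conv)
qed

lemma list_recursive_rec2:
  assumes "total_recursive f" "list_recursive 3 (\<lambda>xs. g (xs ! 0) (xs ! 1) (xs ! 2))"
  shows "list_recursive 2 (\<lambda>xs. rec_nat (f (xs ! 1)) (\<lambda>m y. g y m (xs ! 1)) (xs ! 0))"
proof -
  have "list_recursive 2 (\<lambda>xs. rec_nat (f (tl xs ! 0)) (\<lambda>m y. g y m (tl xs ! 0)) (hd xs))"
    using list_recursive_rec[of 1 "\<lambda>xs. f (xs ! 0)" "\<lambda>xs. g (xs ! 0) (xs ! 1) (xs ! 2)"] assms
    by (simp add: numeral_2_eq_2 numeral_3_eq_3 total_recursive_iff)
  then show ?thesis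
    by (rule list_recursive_cong) (auto simp: numeral_2_eq_2 length_Suc_conv)
qed

lemma total_recursive_id: "total_recursive (\<lambda>x. x)"
  by (simp add: total_recursive_iff list_recursive_nth)

lemma list_recursive_app1:
  "total_recursive f \<Longrightarrow> list_recursive n g \<Longrightarrow> list_recursive n (\<lambda>xs. f (g xs))"
  unfolding total_recursive_iff by (drule (1) list_recursive_comp1) simp

lemma list_recursive_app2:
  "list_recursive 2 (\<lambda>xs. f (xs ! 0) (xs ! 1)) \<Longrightarrow> list_recursive n g \<Longrightarrow> list_recursive n h
    \<Longrightarrow> list_recursive n (\<lambda>xs. f (g xs) (h xs))"
  by (drule (2) list_recursive_comp2) simp

lemma list_recursive_add:
  assumes "list_recursive n f" "list_recursive n g"
  shows "list_recursive n (\<lambda>xs. f xs + g xs)"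
proof -
  have "list_recursive 2 (\<lambda>xs. rec_nat (xs ! 1) (\<lambda>m y. Suc y) (xs ! 0))"
    by (rule list_recursive_rec2[of "\<lambda>x. x"])
       (intro list_recursive_Suc list_recursive_nth total_recursive_id; simp)+
  moreover have "rec_nat b (\<lambda>m y. Suc y) a = a + b" for a b :: nat by (induction a) auto
  ultimately have "list_recursive 2 (\<lambda>xs. xs ! 0 + xs ! 1)" by simp
  from list_recursive_app2[of "(+)", OF this assms] show ?thesis by simp
qed

lemma list_recursive_diff:
  assumes "list_recursive n f" "list_recursive n g"
  shows "list_recursive n (\<lambda>xs. f xs - g xs)"
proof -
  have "list_recursive 1 (\<lambda>xs. rec_nat 0 (\<lambda>m y. m) (xs ! 0))"
    by (rule list_recursive_rec1) (auto intro: list_recursive_nth)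
  moreover have "rec_nat 0 (\<lambda>m y. m) a = a - 1" for a :: nat by (cases a) auto
  ultimately have pred: "total_recursive (\<lambda>x. x - 1)" by (simp add: total_recursive_iff)
  have "list_recursive 2 (\<lambda>xs. rec_nat (xs ! 1) (\<lambda>m y. y - 1) (xs ! 0))"
    by (rule list_recursive_rec2[of "\<lambda>x. x"])
       (intro list_recursive_app1[OF pred] list_recursive_nth total_recursive_id; simp)+
  moreover have "rec_nat b (\<lambda>m y. y - 1) a = b - a" for a b :: nat by (induction a) auto
  ultimately have "list_recursive 2 (\<lambda>xs. xs ! 1 - xs ! 0)" by simp
  from list_recursive_app2[of "\<lambda>x y. y - x", OF this assms(2,1)] show ?thesis by simp
qed

lemma total_recursive_triangle: "total_recursive triangle"
proof -
  have "list_recursive 1 (\<lambda>xs. rec_nat 0 (\<lambda>m y. y + Suc m) (xs ! 0))"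
    by (rule list_recursive_rec1)
       (intro list_recursive_nth list_recursive_add list_recursive_Suc; simp)
  moreover have "rec_nat 0 (\<lambda>m y. y + Suc m) a = triangle a" for a by (induction a) auto
  ultimately show ?thesis by (simp add: total_recursive_iff)
qed

definition pi1 :: "nat \<Rightarrow> nat" where "pi1 z = fst (prod_decode z)"
definition pi2 :: "nat \<Rightarrow> nat" where "pi2 z = snd (prod_decode z)"

lemma pi_encode [simp]: "pi1 (prod_encode (a, b)) = a" "pi2 (prod_encode (a, b)) = b"
  by (simp_all add: pi1_def pi2_def)

lemma encode_pi [simp]: "prod_encode (pi1 z, pi2 z) = z"
  by (simp add: pi1_def pi2_def)

lemma pi_le: "pi1 z \<le> z" "pi2 z \<le> z"
  using le_prod_encode_1[of "pi1 z" "pi2 z"] le_prod_encode_2[of "pi2 z" "pi1 z"] by simp_all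

lemma pi_zero [simp]: "pi1 0 = 0" "pi2 0 = 0"
  using pi_le[of 0] by simp_all

text \<open>The sum of the two coordinates of \<open>z\<close> is computed by recursion on \<open>z\<close>: it grows exactly
  when the enumeration of pairs reaches the next diagonal.\<close>

lemma total_recursive_pi: "total_recursive pi1" "total_recursive pi2"
proof -
  define s where "s = rec_nat 0 (\<lambda>m y. y + (1 - (triangle (Suc y) - Suc m)))"
  have s: "list_recursive 1 (\<lambda>xs. s (xs ! 0))" unfolding s_def
    by (rule list_recursive_rec1)
       (intro list_recursive_nth list_recursive_add list_recursive_Suc list_recursive_diff
          list_recursive_zero list_recursive_app1[OF total_recursive_triangle]; simp add: list_recursive_zero list_recursive_Suc)
  have bound: "triangle (s z) \<le> z \<and> z < triangle (Suc (s z))" for z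
  proof (induction z)
    case (Suc z)
    have "s (Suc z) = s z + (1 - (triangle (Suc (s z)) - Suc z))" by (simp add: s_def)
    then have "s (Suc z) = (if triangle (Suc (s z)) \<le> Suc z then Suc (s z) else s z)"
      using Suc by auto
    with Suc show ?case by auto
  qed (simp add: s_def)
  have s_eq: "s (prod_encode (a, b)) = a + b" for a b
  proof -
    have mono: "triangle i \<le> triangle j" if "i \<le> j" for i j
      using that by (induction rule: dec_induct) auto
    have 1: "triangle (a + b) \<le> prod_encode (a, b)" "prod_encode (a, b) < triangle (Suc (a + b))"
      by (auto simp: prod_encode_def)
    show ?thesis
      using mono[of "Suc (s (prod_encode (a, b)))" "a + b"]
        mono[of "Suc (a + b)" "s (prod_encode (a, b))"] bound[of "prod_encode (a, b)"] 1
      by (metis Suc_leI leD le_less_trans linorder_neqE_nat)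
  qed
  have p1: "pi1 z = z - triangle (s z)" for z
  proof -
    have "z = triangle (pi1 z + pi2 z) + pi1 z"
      using encode_pi[of z] unfolding prod_encode_def by simp
    then show ?thesis using s_eq[of "pi1 z" "pi2 z"] by simp
  qed
  have p2: "pi2 z = s z - pi1 z" for z
    using s_eq[of "pi1 z" "pi2 z"] by simp
  have "list_recursive 1 (\<lambda>xs. xs ! 0 - triangle (s (xs ! 0)))"
    by (intro list_recursive_diff list_recursive_nth s
         list_recursive_app1[OF total_recursive_triangle]) simp
  then show 1: "total_recursive pi1" by (simp add: total_recursive_iff p1)
  have "list_recursive 1 (\<lambda>xs. s (xs ! 0) - pi1 (xs ! 0))"
    by (intro list_recursive_diff list_recursive_nth s list_recursive_app1[OF 1]) simp
  then show "total_recursive pi2" by (simp add: total_recursive_iff p2)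
qed

lemma list_recursive_prod_encode:
  "list_recursive n f \<Longrightarrow> list_recursive n g \<Longrightarrow> list_recursive n (\<lambda>xs. prod_encode (f xs, g xs))"
  unfolding prod_encode_def case_prod_conv
  by (intro list_recursive_add list_recursive_app1[OF total_recursive_triangle])

lemma total_recursive_comp:
  "total_recursive f \<Longrightarrow> total_recursive g \<Longrightarrow> total_recursive (\<lambda>x. f (g x))"
  using list_recursive_app1[of f 1 "\<lambda>xs. g (xs ! 0)"] by (simp add: total_recursive_iff)

lemma total_recursive_const: "total_recursive (\<lambda>x. c)"
  unfolding total_recursive_iff
  by (induction c) (auto intro: list_recursive_zero list_recursive_Suc)

lemma total_recursive_basic:
  assumes "total_recursive f"
  shows total_recursive_Suc: "total_recursive (\<lambda>x. Suc (f x))"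
    and total_recursive_pi1: "total_recursive (\<lambda>x. pi1 (f x))"
    and total_recursive_pi2: "total_recursive (\<lambda>x. pi2 (f x))"
  using assms total_recursive_comp[OF total_recursive_pi(1) assms]
    total_recursive_comp[OF total_recursive_pi(2) assms]
  by (simp_all add: total_recursive_iff list_recursive_Suc)

lemma total_recursive_binary:
  assumes "total_recursive f" "total_recursive g"
  shows total_recursive_add: "total_recursive (\<lambda>x. f x + g x)"
    and total_recursive_diff: "total_recursive (\<lambda>x. f x - g x)"
    and total_recursive_prod_encode: "total_recursive (\<lambda>x. prod_encode (f x, g x))"
  using assms
  by (simp_all add: total_recursive_iff list_recursive_add list_recursive_diff list_recursive_prod_encode)

text \<open>A context of several variables is coded as a nested pair, so that a function of the
  bound variables \<open>y\<close>, \<open>m\<close> and of \<open>x\<close> is a function of the single number \<open>z\<close>.\<close>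

lemma total_recursive_rec:
  assumes f: "total_recursive f"
    and g: "total_recursive (\<lambda>z. g (pi1 z) (pi1 (pi2 z)) (pi2 (pi2 z)))" and h: "total_recursive h"
  shows "total_recursive (\<lambda>x. rec_nat (f x) (\<lambda>m y. g y m x) (h x))"
proof -
  have "list_recursive 3 (\<lambda>xs. prod_encode (xs ! 0, prod_encode (xs ! 1, xs ! 2)))"
    by (intro list_recursive_prod_encode list_recursive_nth) auto
  from list_recursive_app1[OF g this]
  have "list_recursive 3 (\<lambda>xs. g (xs ! 0) (xs ! 1) (xs ! 2))" by simp
  from list_recursive_app2[OF list_recursive_rec2[OF f this], of 1 "\<lambda>xs. h (xs ! 0)" "\<lambda>xs. xs ! 0"]
    h show ?thesis
    by (simp add: total_recursive_iff list_recursive_nth)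
qed

lemma total_recursive_mult:
  assumes "total_recursive f" "total_recursive g"
  shows "total_recursive (\<lambda>x. f x * g x)"
proof -
  have "total_recursive (\<lambda>x. rec_nat 0 (\<lambda>m y. y + g x) (f x))"
    by (intro total_recursive_rec total_recursive_const total_recursive_add total_recursive_pi1
        total_recursive_pi2 total_recursive_id total_recursive_comp[OF assms(2)] assms(1))
  moreover have "rec_nat 0 (\<lambda>m y. y + b) a = a * b" for a b :: nat by (induction a) auto
  ultimately show ?thesis by simp
qed

section \<open>Decidable predicates and bounded quantifiers\<close>

definition decidable :: "(nat \<Rightarrow> bool) \<Rightarrow> bool" where
  "decidable P \<longleftrightarrow> total_recursive (\<lambda>x. if P x then 1 else 0)"

lemma total_recursive_if:
  assumes "decidable P" "total_recursive f" "total_recursive g"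
  shows "total_recursive (\<lambda>x. if P x then f x else g x)"
proof -
  have "total_recursive (\<lambda>x. (if P x then 1 else 0) * f x + (1 - (if P x then 1 else 0)) * g x)"
    by (intro total_recursive_add total_recursive_mult total_recursive_diff total_recursive_const
        assms assms(1)[unfolded decidable_def])
  moreover have "(\<lambda>x. (if P x then 1 else 0) * f x + (1 - (if P x then 1 else 0)) * g x)
    = (\<lambda>x. if P x then f x else g x)" by auto
  ultimately show ?thesis by simp
qed

lemma decidable_le:
  assumes "total_recursive f" "total_recursive g"
  shows "decidable (\<lambda>x. f x \<le> g x)"
proof -
  have "total_recursive (\<lambda>x. 1 - (f x - g x))"
    by (intro total_recursive_diff total_recursive_const assms)
  moreover have "(\<lambda>x. 1 - (f x - g x)) = (\<lambda>x. if f x \<le> g x then 1 else 0)" by auto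
  ultimately show ?thesis unfolding decidable_def by simp
qed

lemma decidable_less:
  "total_recursive f \<Longrightarrow> total_recursive g \<Longrightarrow> decidable (\<lambda>x. f x < g x)"
  using decidable_le[of "\<lambda>x. Suc (f x)" g] by (simp add: total_recursive_Suc Suc_le_eq)

lemma decidable_const: "decidable (\<lambda>x. c)"
  unfolding decidable_def by (rule total_recursive_const)

lemma decidable_if:
  "decidable P \<Longrightarrow> decidable Q \<Longrightarrow> decidable S \<Longrightarrow> decidable (\<lambda>x. if P x then Q x else S x)"
proof -
  assume "decidable P" "decidable Q" "decidable S"
  then have "total_recursive (\<lambda>x. if P x then if Q x then 1 else 0 else if S x then 1 else 0)"
    using total_recursive_if by (simp add: decidable_def)
  moreover have "(\<lambda>x. if P x then if Q x then 1 else 0 else if S x then 1 else 0)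
    = (\<lambda>x. if if P x then Q x else S x then 1 else (0::nat))" by auto
  ultimately show ?thesis by (simp add: decidable_def)
qed

lemma decidable_not: "decidable P \<Longrightarrow> decidable (\<lambda>x. \<not> P x)"
  using decidable_if[of P "\<lambda>x. False" "\<lambda>x. True"] by (simp add: decidable_const if_bool_eq_conj)

lemma decidable_conj: "decidable P \<Longrightarrow> decidable Q \<Longrightarrow> decidable (\<lambda>x. P x \<and> Q x)"
  using decidable_if[of P Q "\<lambda>x. False"] by (simp add: decidable_const if_bool_eq_disj)

lemma decidable_disj: "decidable P \<Longrightarrow> decidable Q \<Longrightarrow> decidable (\<lambda>x. P x \<or> Q x)"
  using decidable_not[OF decidable_conj[OF decidable_not decidable_not], of P Q] by simp

lemma decidable_imp: "decidable P \<Longrightarrow> decidable Q \<Longrightarrow> decidable (\<lambda>x. P x \<longrightarrow> Q x)"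
  using decidable_if[of P Q "\<lambda>x. True"] by (simp add: decidable_const if_bool_eq_conj)

lemma decidable_eq:
  "total_recursive f \<Longrightarrow> total_recursive g \<Longrightarrow> decidable (\<lambda>x. f x = g x)"
  using decidable_conj[OF decidable_le[of f g] decidable_le[of g f]]
  by (simp add: eq_iff)

lemma decidable_comp: "decidable P \<Longrightarrow> total_recursive f \<Longrightarrow> decidable (\<lambda>x. P (f x))"
  unfolding decidable_def by (erule (1) total_recursive_comp)

text \<open>Bounded search is primitive recursion on the bound: the accumulator becomes 1 at the
  first witness and stays 1. In the premise the bound variable and the context form one coded pair,
  so that nested quantifiers are handled by applying the rule again.\<close>

lemma decidable_bex:
  assumes "decidable (\<lambda>z. P (pi1 z) (pi2 z))" "total_recursive b"
  shows "decidable (\<lambda>x. \<exists>i<b x. P i x)"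
proof -
  have P: "decidable (\<lambda>z. P (pi1 (pi2 z)) (pi2 (pi2 z)))"
    using decidable_comp[OF assms(1) total_recursive_pi(2)] .
  have "total_recursive (\<lambda>x. rec_nat 0 (\<lambda>m y. if P m x then 1 else y) (b x))"
    by (intro total_recursive_rec total_recursive_if P total_recursive_const total_recursive_pi
        assms(2))
  moreover have "rec_nat 0 (\<lambda>m y. if P m x then 1 else y) k = (if \<exists>i<k. P i x then 1 else (0::nat))"
    for k x by (induction k) (auto simp: less_Suc_eq)
  ultimately show ?thesis by (simp add: decidable_def)
qed

lemma decidable_ball:
  "decidable (\<lambda>z. P (pi1 z) (pi2 z)) \<Longrightarrow> total_recursive b \<Longrightarrow> decidable (\<lambda>x. \<forall>i<b x. P i x)"
  using decidable_not[OF decidable_bex[of "\<lambda>i x. \<not> P i x" b]] by (simp add: decidable_not)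

lemma total_recursive_half: "total_recursive f \<Longrightarrow> total_recursive (\<lambda>x. f x div 2)"
proof (rule total_recursive_comp[of "\<lambda>x. x div 2" f])
  \<comment> \<open>With \<open>y = m div 2\<close>, the half grows in passing from \<open>m\<close>
    to \<open>Suc m\<close> exactly when \<open>m\<close> is odd, that is, when \<open>y + y\<close>
    differs from \<open>m\<close>.\<close>
  have "total_recursive (\<lambda>x. rec_nat 0 (\<lambda>m y. if y + y = m then y else Suc y) x)"
    by (intro total_recursive_rec total_recursive_if decidable_eq total_recursive_add total_recursive_Suc
        total_recursive_const total_recursive_pi1 total_recursive_pi2 total_recursive_id)
  moreover have "rec_nat 0 (\<lambda>m y. if y + y = m then y else Suc y) k = k div 2" for k
    by (induction k) (simp, simp, presburger)
  ultimately show "total_recursive (\<lambda>x. x div 2)" by simp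
qed

lemma decidable_even: "total_recursive f \<Longrightarrow> decidable (\<lambda>x. even (f x))"
proof -
  have "even m \<longleftrightarrow> m div 2 + m div 2 = m" for m :: nat by presburger
  then show "total_recursive f \<Longrightarrow> ?thesis"
    by (simp add: decidable_eq total_recursive_add total_recursive_half)
qed

section \<open>Coded lists\<close>

definition lnth :: "nat \<Rightarrow> nat \<Rightarrow> nat" where
  "lnth t i = (let xs = list_decode t in if i < length xs then xs ! i else 0)"

definition llength :: "nat \<Rightarrow> nat" where "llength t = length (list_decode t)"

text \<open>A nonempty list is coded by the successor of the pair of its head and the code of its
  tail, so the tail is the second projection of the predecessor. The code 0 of the empty list is
  fixed by this operation, hence dropping beyond the end is harmless.\<close>

lemma list_encode_drop:
  "rec_nat (list_encode xs) (\<lambda>m y. pi2 (y - 1)) i = list_encode (drop i xs)"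
proof (induction i)
  case (Suc i)
  have "pi2 (list_encode ys - 1) = list_encode (tl ys)" for ys
    by (cases ys) simp_all
  with Suc show ?case by (simp add: drop_Suc tl_drop)
qed simp

lemma total_recursive_drop:
  assumes "total_recursive t" "total_recursive i"
  shows "total_recursive (\<lambda>x. list_encode (drop (i x) (list_decode (t x))))"
proof -
  have "total_recursive (\<lambda>x. rec_nat (t x) (\<lambda>m y. pi2 (y - 1)) (i x))"
    by (intro total_recursive_rec total_recursive_diff total_recursive_pi1 total_recursive_pi2
        total_recursive_const total_recursive_id assms)
  then show ?thesis using list_encode_drop[of "list_decode _"] by simp
qed

lemma total_recursive_lnth:
  assumes "total_recursive t" "total_recursive i"
  shows "total_recursive (\<lambda>x. lnth (t x) (i x))"
proof -
  have "pi1 (list_encode (drop i xs) - 1) = (if i < length xs then xs ! i else 0)" for i xs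
    using Cons_nth_drop_Suc[of i xs, symmetric] by (cases "i < length xs") simp_all
  then have "lnth (t x) (i x) = pi1 (list_encode (drop (i x) (list_decode (t x))) - 1)" for x
    by (simp add: lnth_def Let_def)
  then show ?thesis
    by (simp add: total_recursive_pi1 total_recursive_diff total_recursive_const
        total_recursive_drop assms)
qed

lemma length_le_list_encode: "length xs \<le> list_encode xs"
proof (induction xs)
  case (Cons x xs)
  then show ?case using le_prod_encode_2[of "list_encode xs" x] by simp
qed simp

text \<open>The length is the number of \<open>m\<close> for which dropping \<open>m\<close> entries
  leaves something. A code is at least the length of its list, so the code itself bounds the
  count.\<close>

lemma total_recursive_llength: "total_recursive t \<Longrightarrow> total_recursive (\<lambda>x. llength (t x))"
proof (rule total_recursive_comp[of llength t])
  let ?d = "\<lambda>t i. list_encode (drop i (list_decode t))"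
  have "total_recursive (\<lambda>x. rec_nat 0 (\<lambda>m y. if ?d x m = 0 then y else Suc y) x)"
    by (intro total_recursive_rec total_recursive_if decidable_eq total_recursive_drop total_recursive_Suc
        total_recursive_const total_recursive_pi1 total_recursive_pi2 total_recursive_id)
  moreover have "rec_nat 0 (\<lambda>m y. if ?d t m = 0 then y else Suc y) k = min k (llength t)" for t k
  proof (induction k)
    case (Suc k)
    have "list_encode ys = 0 \<longleftrightarrow> ys = []" for ys by (cases ys) auto
    with Suc show ?case by (auto simp: llength_def)
  qed simp
  moreover have "min t (llength t) = llength t" for t
    using length_le_list_encode[of "list_decode t"] by (simp add: llength_def)
  ultimately show "total_recursive llength" by simp
qed

lemma total_recursive_list_encode_map:
  assumes f: "total_recursive (\<lambda>z. f (pi1 z) (pi2 z))" and b: "total_recursive b"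
  shows "total_recursive (\<lambda>x. list_encode (map (\<lambda>m. f m x) [0..<b x]))"
proof -
  \<comment> \<open>The list is built from its end by prepending, so step \<open>m\<close> supplies
    the entry of index \<open>b x - 1 - m\<close>. The context of the recursion is the pair of
    \<open>x\<close> and \<open>b x\<close>; this map extracts the arguments of \<open>f\<close>
    from it.\<close>
  have "total_recursive (\<lambda>z. prod_encode (pi2 (pi2 (pi2 z)) - 1 - pi1 (pi2 z), pi1 (pi2 (pi2 z))))"
    by (intro total_recursive_prod_encode total_recursive_diff total_recursive_pi1
        total_recursive_pi2 total_recursive_id total_recursive_const)
  from total_recursive_comp[OF f this]
  have f': "total_recursive (\<lambda>z. f (pi2 (pi2 (pi2 z)) - 1 - pi1 (pi2 z)) (pi1 (pi2 (pi2 z))))" by simp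
  have "total_recursive (\<lambda>w. rec_nat 0 (\<lambda>m y. Suc (prod_encode (f (pi2 w - 1 - m) (pi1 w), y))) (pi2 w))"
    by (intro total_recursive_rec total_recursive_Suc total_recursive_prod_encode f'
        total_recursive_const total_recursive_pi)
  from total_recursive_comp[OF this total_recursive_prod_encode[OF total_recursive_id b]]
  have "total_recursive (\<lambda>x. rec_nat 0 (\<lambda>m y. Suc (prod_encode (f (b x - 1 - m) x, y))) (b x))"
    by simp
  moreover have "rec_nat 0 (\<lambda>m y. Suc (prod_encode (f (k - 1 - m) x, y))) i
      = list_encode (map (\<lambda>m. f m x) [k - i..<k])" if "i \<le> k" for i k x
    using that
  proof (induction i)
    case (Suc i)
    then have "[k - Suc i..<k] = (k - 1 - i) # [k - i..<k]"
      by (simp add: upt_rec[of "k - Suc i"] Suc_diff_Suc)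
    with Suc show ?case by simp
  qed simp
  from this[OF order_refl] have "rec_nat 0 (\<lambda>m y. Suc (prod_encode (f (k - 1 - m) x, y))) k
      = list_encode (map (\<lambda>m. f m x) [0..<k])" for k x by simp
  ultimately show ?thesis by simp
qed

section \<open>Rational-valued functions and their comparison\<close>

text \<open>Values are unreduced fractions with recursive parts. Writing the numerator as a
  difference keeps all three parts natural numbers, and the successor keeps the denominator
  positive.\<close>

definition rat_recursive :: "(nat \<Rightarrow> rat) \<Rightarrow> bool" where
  "rat_recursive f \<longleftrightarrow> (\<exists>u v w. total_recursive u \<and> total_recursive v \<and> total_recursive w \<and>
     (\<forall>x. f x = (of_nat (u x) - of_nat (v x)) / of_nat (Suc (w x))))"

lemma rat_recursive_zero: "rat_recursive (\<lambda>x. 0)"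
  unfolding rat_recursive_def
  by (intro exI[of _ "\<lambda>x. 0"]) (simp add: total_recursive_const)

lemma rat_recursive_rat_of_code:
  assumes "total_recursive f"
  shows "rat_recursive (\<lambda>x. rat_of_code (f x))"
proof -
  let ?m = "\<lambda>x. pi1 (f x)"
  have "rat_of_code (f x) = (of_nat (if even (?m x) then ?m x div 2 else 0)
      - of_nat (if even (?m x) then 0 else Suc (?m x div 2))) / of_nat (Suc (pi2 (f x)))" for x
    by (auto simp: rat_of_code_def pi1_def pi2_def int_decode_def sum_decode_def split: prod.splits)
  moreover have "total_recursive (\<lambda>x. if even (?m x) then ?m x div 2 else 0)"
    "total_recursive (\<lambda>x. if even (?m x) then 0 else Suc (?m x div 2))"
    "total_recursive (\<lambda>x. pi2 (f x))"
    by (intro total_recursive_if total_recursive_half total_recursive_Suc total_recursive_const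
        total_recursive_pi1 total_recursive_pi2 decidable_even assms)+
  ultimately show ?thesis unfolding rat_recursive_def by blast
qed

lemma rat_recursive_add:
  assumes "rat_recursive f" "rat_recursive g"
  shows "rat_recursive (\<lambda>x. f x + g x)"
proof -
  obtain u v w u' v' w' where
    r: "total_recursive u" "total_recursive v" "total_recursive w"
       "total_recursive u'" "total_recursive v'" "total_recursive w'"
    and f: "\<And>x. f x = (of_nat (u x) - of_nat (v x)) / of_nat (Suc (w x))"
    and g: "\<And>x. g x = (of_nat (u' x) - of_nat (v' x)) / of_nat (Suc (w' x))"
    using assms unfolding rat_recursive_def by blast
  \<comment> \<open>The product of \<open>Suc (w x)\<close> and \<open>Suc (w' x)\<close> is the
    successor of \<open>w x * w' x + w x + w' x\<close>, so the common denominator has the required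
    form.\<close>
  have "f x + g x = (of_nat (u x * Suc (w' x) + u' x * Suc (w x)) - of_nat (v x * Suc (w' x) + v' x * Suc (w x)))
     / of_nat (Suc (w x * w' x + w x + w' x))" for x
  proof -
    have 1: "of_nat (Suc (w x * w' x + w x + w' x)) = (of_nat (Suc (w x)) * of_nat (Suc (w' x)) :: rat)"
      by (simp add: algebra_simps)
    have 2: "of_nat (Suc (w x)) \<noteq> (0::rat)" "of_nat (Suc (w' x)) \<noteq> (0::rat)"
      by (simp_all del: of_nat_Suc)
    show ?thesis unfolding f g 1 using 2
      by (simp add: add_frac_eq del: of_nat_Suc) (simp add: algebra_simps)
  qed
  moreover have "total_recursive (\<lambda>x. u x * Suc (w' x) + u' x * Suc (w x))"
    "total_recursive (\<lambda>x. v x * Suc (w' x) + v' x * Suc (w x))"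
    "total_recursive (\<lambda>x. w x * w' x + w x + w' x)"
    by (intro total_recursive_add total_recursive_mult total_recursive_Suc r)+
  ultimately show ?thesis unfolding rat_recursive_def by blast
qed

lemma rat_recursive_mult:
  assumes "rat_recursive f" "rat_recursive g"
  shows "rat_recursive (\<lambda>x. f x * g x)"
proof -
  obtain u v w u' v' w' where
    r: "total_recursive u" "total_recursive v" "total_recursive w"
       "total_recursive u'" "total_recursive v'" "total_recursive w'"
    and f: "\<And>x. f x = (of_nat (u x) - of_nat (v x)) / of_nat (Suc (w x))"
    and g: "\<And>x. g x = (of_nat (u' x) - of_nat (v' x)) / of_nat (Suc (w' x))"
    using assms unfolding rat_recursive_def by blast
  have "f x * g x = (of_nat (u x * u' x + v x * v' x) - of_nat (u x * v' x + v x * u' x))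
     / of_nat (Suc (w x * w' x + w x + w' x))" for x
  proof -
    have 1: "of_nat (Suc (w x * w' x + w x + w' x)) = (of_nat (Suc (w x)) * of_nat (Suc (w' x)) :: rat)"
      by (simp add: algebra_simps)
    show ?thesis unfolding f g 1 by (simp add: algebra_simps del: of_nat_Suc)
  qed
  moreover have "total_recursive (\<lambda>x. u x * u' x + v x * v' x)"
    "total_recursive (\<lambda>x. u x * v' x + v x * u' x)"
    "total_recursive (\<lambda>x. w x * w' x + w x + w' x)"
    by (intro total_recursive_add total_recursive_mult r)+
  ultimately show ?thesis unfolding rat_recursive_def by blast
qed

lemma decidable_rat_less:
  assumes "rat_recursive f" "rat_recursive g"
  shows "decidable (\<lambda>x. f x < g x)"
proof -
  obtain u v w u' v' w' where
    r: "total_recursive u" "total_recursive v" "total_recursive w"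
       "total_recursive u'" "total_recursive v'" "total_recursive w'"
    and f: "\<And>x. f x = (of_nat (u x) - of_nat (v x)) / of_nat (Suc (w x))"
    and g: "\<And>x. g x = (of_nat (u' x) - of_nat (v' x)) / of_nat (Suc (w' x))"
    using assms unfolding rat_recursive_def by blast
  \<comment> \<open>Multiply by both positive denominators and move the subtracted parts across: an
    inequality between natural numbers remains.\<close>
  have "f x < g x \<longleftrightarrow> u x * Suc (w' x) + v' x * Suc (w x) < u' x * Suc (w x) + v x * Suc (w' x)" for x
  proof -
    have 2: "of_nat (Suc (w x)) > (0::rat)" "of_nat (Suc (w' x)) > (0::rat)"
      by (simp_all del: of_nat_Suc)
    have "f x < g x \<longleftrightarrow> (of_nat (u x) - of_nat (v x)) * of_nat (Suc (w' x))
        < (of_nat (u' x) - of_nat (v' x)) * (of_nat (Suc (w x)) :: rat)"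
      unfolding f g using 2 by (simp add: field_simps del: of_nat_Suc)
    also have "\<dots> \<longleftrightarrow> of_nat (u x * Suc (w' x) + v' x * Suc (w x))
        < (of_nat (u' x * Suc (w x) + v x * Suc (w' x)) :: rat)"
      unfolding of_nat_add of_nat_mult by (auto simp: algebra_simps simp del: of_nat_Suc)
    finally show ?thesis by (simp only: of_nat_less_iff)
  qed
  moreover have "decidable (\<lambda>x. u x * Suc (w' x) + v' x * Suc (w x) < u' x * Suc (w x) + v x * Suc (w' x))"
    by (intro decidable_less total_recursive_add total_recursive_mult total_recursive_Suc r)
  ultimately show ?thesis by simp
qed

lemma decidable_rat_le: "rat_recursive f \<Longrightarrow> rat_recursive g \<Longrightarrow> decidable (\<lambda>x. f x \<le> g x)"
  using decidable_not[OF decidable_rat_less[of g f]] by (simp add: not_less)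

lemma rat_recursive_if:
  assumes P: "decidable P" and "rat_recursive f" "rat_recursive g"
  shows "rat_recursive (\<lambda>x. if P x then f x else g x)"
proof -
  obtain u v w u' v' w' where
    r: "total_recursive u" "total_recursive v" "total_recursive w"
       "total_recursive u'" "total_recursive v'" "total_recursive w'"
    and f: "\<And>x. f x = (of_nat (u x) - of_nat (v x)) / of_nat (Suc (w x))"
    and g: "\<And>x. g x = (of_nat (u' x) - of_nat (v' x)) / of_nat (Suc (w' x))"
    using assms unfolding rat_recursive_def by blast
  have "total_recursive (\<lambda>x. if P x then u x else u' x)" "total_recursive (\<lambda>x. if P x then v x else v' x)"
    "total_recursive (\<lambda>x. if P x then w x else w' x)"
    by (intro total_recursive_if P r)+
  then show ?thesis unfolding rat_recursive_def
    by (intro exI[of _ "\<lambda>x. if P x then u x else u' x"] exI[of _ "\<lambda>x. if P x then v x else v' x"]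
        exI[of _ "\<lambda>x. if P x then w x else w' x"]) (auto simp: f g)
qed

text \<open>One rule per construct, so that decidability of a formula follows its syntax. This is
  why every quantifier in the search predicates below is bounded.\<close>

lemmas recursive_intros =
  total_recursive_id total_recursive_const total_recursive_Suc total_recursive_pi1 total_recursive_pi2
  total_recursive_add total_recursive_diff total_recursive_mult total_recursive_prod_encode
  total_recursive_if total_recursive_half total_recursive_lnth total_recursive_llength
  decidable_le decidable_less decidable_eq decidable_even decidable_not decidable_conj
  decidable_disj decidable_imp decidable_bex decidable_ball decidable_if decidable_const
  decidable_rat_less decidable_rat_le rat_recursive_zero rat_recursive_add rat_recursive_mult
  rat_recursive_if rat_recursive_rat_of_code

section \<open>Rational rectangles and grids\<close>

definition planar_set :: "nat \<Rightarrow> complex set" where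
  "planar_set k = {z. Some z \<in> bset k}"

abbreviation real_of_code :: "nat \<Rightarrow> real" where
  "real_of_code m \<equiv> of_rat (rat_of_code m)"

text \<open>Doubling codes the left summand: even codes are rectangles, odd codes are exteriors of
  disks.\<close>

definition rect_code :: "nat \<Rightarrow> nat \<Rightarrow> nat \<Rightarrow> nat \<Rightarrow> nat" where
  "rect_code a b c d = 2 * prod_encode (a, prod_encode (b, prod_encode (c, d)))"

lemma planar_set_even:
  assumes "even k"
  shows "planar_set k = box
    (Complex (real_of_code (pi1 (k div 2))) (real_of_code (pi1 (pi2 (pi2 (k div 2))))))
    (Complex (real_of_code (pi1 (pi2 (k div 2)))) (real_of_code (pi2 (pi2 (pi2 (k div 2))))))"
  using assms
  by (auto simp: planar_set_def bset_def basic_of_code_def sum_decode_def pi1_def pi2_def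
      in_box_complex_iff split: prod.splits)

lemma planar_set_odd: "odd k \<Longrightarrow> planar_set k = - cball 0 (real_of_code (k div 2))"
  by (auto simp: planar_set_def bset_def basic_of_code_def sum_decode_def)

lemma planar_set_rect_code: "planar_set (rect_code a b c d) =
    box (Complex (real_of_code a) (real_of_code c)) (Complex (real_of_code b) (real_of_code d))"
  by (simp add: planar_set_even rect_code_def)

lemma open_planar_set: "open (planar_set k)"
  by (cases "even k") (auto simp: planar_set_even planar_set_odd open_box)

text \<open>For a rectangle, the first two disjuncts cover the empty one, whose closure is empty
  too. For the exterior of a disk, disjointness from its closure means lying in the open disk, which
  is tested at the four corners; squares avoid roots, and the sign that they lose is restored by
  requiring a positive radius.\<close>

definition separated :: "nat \<Rightarrow> nat \<Rightarrow> nat \<Rightarrow> nat \<Rightarrow> nat \<Rightarrow> bool" where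
  "separated l1 h1 l2 h2 k \<longleftrightarrow>
    (if even k then
       rat_of_code (pi1 (pi2 (k div 2))) \<le> rat_of_code (pi1 (k div 2)) \<or>
       rat_of_code (pi2 (pi2 (pi2 (k div 2)))) \<le> rat_of_code (pi1 (pi2 (pi2 (k div 2)))) \<or>
       rat_of_code h1 < rat_of_code (pi1 (k div 2)) \<or>
       rat_of_code (pi1 (pi2 (k div 2))) < rat_of_code l1 \<or>
       rat_of_code h2 < rat_of_code (pi1 (pi2 (pi2 (k div 2)))) \<or>
       rat_of_code (pi2 (pi2 (pi2 (k div 2)))) < rat_of_code l2
     else 0 < rat_of_code (k div 2) \<and>
       rat_of_code l1 * rat_of_code l1 + rat_of_code l2 * rat_of_code l2
         < rat_of_code (k div 2) * rat_of_code (k div 2) \<and>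
       rat_of_code l1 * rat_of_code l1 + rat_of_code h2 * rat_of_code h2
         < rat_of_code (k div 2) * rat_of_code (k div 2) \<and>
       rat_of_code h1 * rat_of_code h1 + rat_of_code l2 * rat_of_code l2
         < rat_of_code (k div 2) * rat_of_code (k div 2) \<and>
       rat_of_code h1 * rat_of_code h1 + rat_of_code h2 * rat_of_code h2
         < rat_of_code (k div 2) * rat_of_code (k div 2))"

lemma cbox_disjoint_iff:
  fixes l1 h1 l2 h2 a b c d :: real
  assumes "l1 \<le> h1" "l2 \<le> h2"
  shows "cbox (Complex l1 l2) (Complex h1 h2) \<inter> closure (box (Complex a c) (Complex b d)) = {} \<longleftrightarrow>
    b \<le> a \<or> d \<le> c \<or> h1 < a \<or> b < l1 \<or> h2 < c \<or> d < l2"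
proof (cases "b \<le> a \<or> d \<le> c")
  case True
  then have "box (Complex a c) (Complex b d) = {}" by (auto simp: in_box_complex_iff set_eq_iff)
  then show ?thesis using True by auto
next
  case False
  then have "Complex ((a + b) / 2) ((c + d) / 2) \<in> box (Complex a c) (Complex b d)"
    by (auto simp: in_box_complex_iff)
  then have cl: "closure (box (Complex a c) (Complex b d)) = cbox (Complex a c) (Complex b d)"
    by (intro closure_box) auto
  have "h1 < a \<or> b < l1 \<or> h2 < c \<or> d < l2"
    if "cbox (Complex l1 l2) (Complex h1 h2) \<inter> cbox (Complex a c) (Complex b d) = {}"
  proof (rule ccontr)
    assume "\<not> ?thesis"
    \<comment> \<open>This is the lower left corner of the intersection of the two boxes.\<close>
    then have "Complex (max l1 a) (max l2 c) \<in>
        cbox (Complex l1 l2) (Complex h1 h2) \<inter> cbox (Complex a c) (Complex b d)"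
      using False assms by (auto simp: in_cbox_complex_iff)
    with that show False by simp
  qed
  then show ?thesis using False unfolding cl by (auto simp: in_cbox_complex_iff)
qed

lemma norm_less_iff_squares:
  "norm z < r \<longleftrightarrow> 0 < r \<and> Re z * Re z + Im z * Im z < r * r"
  using norm_ge_zero[of z] power2_less_imp_less[of "norm z" r] power_strict_mono[of "norm z" r 2]
    le_less_trans[of 0 "norm z" r]
  by (auto simp: cmod_power2[symmetric] power2_eq_square[symmetric])

text \<open>On an interval the square is largest at an endpoint; used in both coordinates, this puts
  the maximal modulus on a rectangle at a corner.\<close>

lemma square_le_endpoints:
  fixes x l h :: real
  assumes "l \<le> x" "x \<le> h"
  shows "x * x \<le> l * l \<or> x * x \<le> h * h"
proof (cases "0 \<le> x")
  case True
  then show ?thesis using assms mult_mono[of x h x h] by auto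
next
  case False
  then show ?thesis using assms mult_mono[of "- x" "- l" "- x" "- l"] by auto
qed

lemma cbox_subset_ball_iff:
  fixes l1 h1 l2 h2 r :: real
  assumes "l1 \<le> h1" "l2 \<le> h2"
  shows "cbox (Complex l1 l2) (Complex h1 h2) \<subseteq> ball 0 r \<longleftrightarrow>
    0 < r \<and> l1 * l1 + l2 * l2 < r * r \<and> l1 * l1 + h2 * h2 < r * r \<and>
    h1 * h1 + l2 * l2 < r * r \<and> h1 * h1 + h2 * h2 < r * r" (is "?L \<longleftrightarrow> ?R")
proof
  assume L: ?L
  have "Complex x y \<in> ball 0 r" if "x = l1 \<or> x = h1" "y = l2 \<or> y = h2" for x y
    using that assms by (intro subsetD[OF L]) (auto simp: in_cbox_complex_iff)
  then show ?R by (auto simp: norm_less_iff_squares)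
next
  assume R: ?R
  show ?L
  proof
    fix z assume "z \<in> cbox (Complex l1 l2) (Complex h1 h2)"
    then have "l1 \<le> Re z" "Re z \<le> h1" "l2 \<le> Im z" "Im z \<le> h2" by (auto simp: in_cbox_complex_iff)
    then have "Re z * Re z \<le> l1 * l1 \<or> Re z * Re z \<le> h1 * h1"
      "Im z * Im z \<le> l2 * l2 \<or> Im z * Im z \<le> h2 * h2"
      by (simp_all add: square_le_endpoints)
    then show "z \<in> ball 0 r" using R by (auto simp: norm_less_iff_squares)
  qed
qed

lemma separated_iff:
  assumes "real_of_code l1 \<le> real_of_code h1" "real_of_code l2 \<le> real_of_code h2"
  shows "separated l1 h1 l2 h2 k \<longleftrightarrow>
    cbox (Complex (real_of_code l1) (real_of_code l2)) (Complex (real_of_code h1) (real_of_code h2))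
      \<inter> closure (planar_set k) = {}"
proof (cases "even k")
  case True
  then show ?thesis
    unfolding planar_set_even[OF True] cbox_disjoint_iff[OF assms]
    by (simp add: separated_def of_rat_less of_rat_less_eq)
next
  case False
  have "X \<inter> closure (planar_set k) = {} \<longleftrightarrow> X \<subseteq> ball 0 (real_of_code (k div 2))" for X
    unfolding planar_set_odd[OF False] closure_complement interior_cball by blast
  then show ?thesis using False
    by (simp only: cbox_subset_ball_iff[OF assms])
       (simp add: separated_def of_rat_less of_rat_mult[symmetric] of_rat_add[symmetric] del: of_rat_mult of_rat_add)
qed

text \<open>For \<open>l \<le> h\<close> this is the point of the interval nearest to 0, so two
  clamps give the point of a rectangle nearest to the origin.\<close>

definition clamp0 :: "'a::linordered_idom \<Rightarrow> 'a \<Rightarrow> 'a" where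
  "clamp0 l h = (if 0 < l then l else if h < 0 then h else 0)"

text \<open>The exterior of a disk contains the rectangle iff it contains the rectangle's point
  nearest to the origin. A negative radius, whose exterior is the whole plane, is listed apart
  because squaring forgets its sign.\<close>

definition inside :: "nat \<Rightarrow> nat \<Rightarrow> nat \<Rightarrow> nat \<Rightarrow> nat \<Rightarrow> bool" where
  "inside l1 h1 l2 h2 k \<longleftrightarrow>
    (if even k then
       rat_of_code (pi1 (k div 2)) < rat_of_code l1 \<and>
       rat_of_code h1 < rat_of_code (pi1 (pi2 (k div 2))) \<and>
       rat_of_code (pi1 (pi2 (pi2 (k div 2)))) < rat_of_code l2 \<and>
       rat_of_code h2 < rat_of_code (pi2 (pi2 (pi2 (k div 2))))
     else rat_of_code (k div 2) < 0 \<or>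
       rat_of_code (k div 2) * rat_of_code (k div 2)
         < clamp0 (rat_of_code l1) (rat_of_code h1) * clamp0 (rat_of_code l1) (rat_of_code h1)
         + clamp0 (rat_of_code l2) (rat_of_code h2) * clamp0 (rat_of_code l2) (rat_of_code h2))"

lemma clamp0:
  fixes l h :: "'a::linordered_idom"
  assumes "l \<le> h"
  shows "l \<le> clamp0 l h" "clamp0 l h \<le> h"
    "l \<le> x \<Longrightarrow> x \<le> h \<Longrightarrow> clamp0 l h * clamp0 l h \<le> x * x"
  using assms mult_mono[of l x l x] mult_mono[of "- h" "- x" "- h" "- x"] by (auto simp: clamp0_def)

lemma of_rat_clamp0: "of_rat (clamp0 a b) = (clamp0 (of_rat a) (of_rat b) :: real)"
  by (simp add: clamp0_def)

lemma inside_iff: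
  assumes le: "real_of_code l1 \<le> real_of_code h1" "real_of_code l2 \<le> real_of_code h2"
  shows "inside l1 h1 l2 h2 k \<longleftrightarrow>
    cbox (Complex (real_of_code l1) (real_of_code l2)) (Complex (real_of_code h1) (real_of_code h2))
      \<subseteq> planar_set k"
proof (cases "even k")
  case True
  then show ?thesis
    using le unfolding planar_set_even[OF True] subset_box_complex
    by (auto simp: inside_def of_rat_less of_rat_less_eq)
next
  case False
  define r where "r = real_of_code (k div 2)"
  let ?c = "\<lambda>l h. clamp0 (real_of_code l) (real_of_code h)"
  have out: "r < norm z \<longleftrightarrow> r < 0 \<or> r * r < Re z * Re z + Im z * Im z" for z
  proof (cases "r < 0")
    case True
    then show ?thesis using norm_ge_zero[of z] by linarith
  next
    case False
    then show ?thesis using power2_less_imp_less[of r "norm z"] power_strict_mono[of r "norm z" 2]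
      by (auto simp: cmod_power2[symmetric] power2_eq_square[symmetric])
  qed
  have "inside l1 h1 l2 h2 k \<longleftrightarrow> r < 0 \<or> r * r < ?c l1 h1 * ?c l1 h1 + ?c l2 h2 * ?c l2 h2"
    using False
    by (simp add: inside_def of_rat_less r_def of_rat_mult[symmetric] of_rat_add[symmetric]
       of_rat_clamp0[symmetric] del: of_rat_mult of_rat_add)
  also have "\<dots> \<longleftrightarrow> (\<forall>z \<in> cbox (Complex (real_of_code l1) (real_of_code l2))
      (Complex (real_of_code h1) (real_of_code h2)). r < norm z)" (is "?L \<longleftrightarrow> ?R")
  proof
    assume L: ?L
    show ?R
    proof
      fix z assume "z \<in> cbox (Complex (real_of_code l1) (real_of_code l2))
        (Complex (real_of_code h1) (real_of_code h2))"
      then have "?c l1 h1 * ?c l1 h1 \<le> Re z * Re z" "?c l2 h2 * ?c l2 h2 \<le> Im z * Im z"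
        using le by (auto simp: in_cbox_complex_iff intro: clamp0)
      then show "r < norm z" using L unfolding out by linarith
    qed
  next
    assume ?R
    then have "r < norm (Complex (?c l1 h1) (?c l2 h2))"
      using le by (simp add: in_cbox_complex_iff clamp0)
    then show ?L unfolding out by simp
  qed
  also have "\<dots> \<longleftrightarrow> cbox (Complex (real_of_code l1) (real_of_code l2))
      (Complex (real_of_code h1) (real_of_code h2)) \<subseteq> planar_set k"
    using False by (auto simp: planar_set_odd r_def not_le)
  finally show ?thesis .
qed

text \<open>The grid of mesh \<open>1 / d\<close> with its origin shifted to \<open>(-w / d, -w / d)\<close>, so that its
  points have natural coordinates.\<close>

definition grid_code :: "nat \<Rightarrow> nat \<Rightarrow> nat \<Rightarrow> nat" where
  "grid_code w d u = prod_encode (int_encode (int u - int w), d - 1)"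

lemma real_of_grid_code: "0 < d \<Longrightarrow> real_of_code (grid_code w d u) = (real u - real w) / real d"
  by (simp add: grid_code_def rat_of_code_def of_rat_divide of_rat_diff)

definition cell :: "nat \<Rightarrow> nat \<Rightarrow> nat \<Rightarrow> nat \<Rightarrow> complex set" where
  "cell w d a b = {z. real a \<le> Re z * d + w \<and> Re z * d + w \<le> real a + 1 \<and>
                      real b \<le> Im z * d + w \<and> Im z * d + w \<le> real b + 1}"

text \<open>The interior of the 3 by 3 array of cells centred at \<open>cell w d a b\<close>: an
  open set that still contains the edges of that closed cell.\<close>

definition block :: "nat \<Rightarrow> nat \<Rightarrow> nat \<Rightarrow> nat \<Rightarrow> complex set" where
  "block w d a b = {z. real a - 1 < Re z * d + w \<and> Re z * d + w < real a + 2 \<and>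
                       real b - 1 < Im z * d + w \<and> Im z * d + w < real b + 2}"

definition cell_code :: "nat \<Rightarrow> nat \<Rightarrow> nat \<Rightarrow> nat \<Rightarrow> nat" where
  "cell_code w d a b = rect_code (grid_code w d a) (grid_code w d (Suc a))
                                 (grid_code w d b) (grid_code w d (Suc b))"

text \<open>Replacing \<open>w\<close> by \<open>Suc w\<close> shifts a coordinate down by one,
  which yields the side \<open>a - 1\<close> without truncation at \<open>a = 0\<close>.\<close>

definition block_code :: "nat \<Rightarrow> nat \<Rightarrow> nat \<Rightarrow> nat \<Rightarrow> nat" where
  "block_code w d a b = rect_code (grid_code (Suc w) d a) (grid_code w d (a + 2))
                                  (grid_code (Suc w) d b) (grid_code w d (b + 2))"

lemma cell_eq_cbox:
  assumes "0 < d"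
  shows "cell w d a b =
    cbox (Complex (real_of_code (grid_code w d a)) (real_of_code (grid_code w d b)))
         (Complex (real_of_code (grid_code w d (Suc a))) (real_of_code (grid_code w d (Suc b))))"
  using assms by (auto simp: cell_def in_cbox_complex_iff real_of_grid_code field_simps)

lemma closure_cell_code:
  assumes "0 < d"
  shows "closure (planar_set (cell_code w d a b)) = cell w d a b"
proof -
  let ?l = "Complex (real_of_code (grid_code w d a)) (real_of_code (grid_code w d b))"
  let ?h = "Complex (real_of_code (grid_code w d (Suc a))) (real_of_code (grid_code w d (Suc b)))"
  have "(?l + ?h) / 2 \<in> box ?l ?h"
    using assms by (simp add: in_box_complex_iff real_of_grid_code field_simps)
  then have "box ?l ?h \<noteq> {}" by blast
  then show ?thesis
    using assms by (simp add: cell_eq_cbox cell_code_def planar_set_rect_code closure_box)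
qed

lemma planar_set_block_code:
  "0 < d \<Longrightarrow> planar_set (block_code w d a b) = block w d a b"
  by (auto simp: block_def block_code_def planar_set_rect_code in_box_complex_iff
     real_of_grid_code field_simps)

lemma separated_cell_iff:
  assumes "0 < d"
  shows "separated (grid_code w d a) (grid_code w d (Suc a)) (grid_code w d b) (grid_code w d (Suc b)) k
     \<longleftrightarrow> cell w d a b \<inter> closure (planar_set k) = {}"
  unfolding cell_eq_cbox[OF assms]
  by (rule separated_iff) (simp_all add: real_of_grid_code assms divide_right_mono)

lemma block_inside:
  assumes "0 < d"
    and "inside (grid_code (Suc w) d a) (grid_code w d (a + 2)) (grid_code (Suc w) d b) (grid_code w d (b + 2)) k"
  shows "block w d a b \<subseteq> planar_set k"
proof -
  have "block w d a b \<subseteq> cbox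
     (Complex (real_of_code (grid_code (Suc w) d a)) (real_of_code (grid_code (Suc w) d b)))
     (Complex (real_of_code (grid_code w d (a + 2))) (real_of_code (grid_code w d (b + 2))))"
    using assms(1) by (auto simp: block_def in_cbox_complex_iff real_of_grid_code field_simps)
  also have "\<dots> \<subseteq> planar_set k"
    using assms by (subst inside_iff[symmetric]) (auto simp: real_of_grid_code divide_right_mono)
  finally show ?thesis .
qed

section \<open>Distances and refinements in the grid\<close>

lemma dist_le_of_grid_coordinates:
  fixes d :: nat and z z' :: complex and m :: real
  assumes "0 < d" "\<bar>Re z * d - Re z' * d\<bar> \<le> m" "\<bar>Im z * d - Im z' * d\<bar> \<le> m"
  shows "dist z z' \<le> 2 * m / d"
proof -
  have "dist z z' \<le> \<bar>Re z - Re z'\<bar> + \<bar>Im z - Im z'\<bar>"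
    unfolding dist_norm using cmod_le[of "z - z'"] by simp
  also have "\<dots> = (\<bar>Re z * d - Re z' * d\<bar> + \<bar>Im z * d - Im z' * d\<bar>) / d"
    using assms(1) by (simp add: left_diff_distrib[symmetric] abs_mult add_divide_distrib)
  also have "\<dots> \<le> 2 * m / d" using assms by (intro divide_right_mono) auto
  finally show ?thesis .
qed

lemma inside_of_small_block:
  assumes "0 < d" "z \<in> cell w d a b" "\<And>z'. dist z z' \<le> 6 / d \<Longrightarrow> z' \<in> planar_set k"
  shows "inside (grid_code (Suc w) d a) (grid_code w d (a + 2)) (grid_code (Suc w) d b) (grid_code w d (b + 2)) k"
proof (subst inside_iff)
  show "cbox (Complex (real_of_code (grid_code (Suc w) d a)) (real_of_code (grid_code (Suc w) d b)))
     (Complex (real_of_code (grid_code w d (a + 2))) (real_of_code (grid_code w d (b + 2)))) \<subseteq> planar_set k"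
  proof
    fix z' assume "z' \<in> cbox (Complex (real_of_code (grid_code (Suc w) d a)) (real_of_code (grid_code (Suc w) d b)))
     (Complex (real_of_code (grid_code w d (a + 2))) (real_of_code (grid_code w d (b + 2))))"
    then have "real a - 1 \<le> Re z' * d + w" "Re z' * d + w \<le> real a + 2"
        "real b - 1 \<le> Im z' * d + w" "Im z' * d + w \<le> real b + 2"
      using assms(1) by (auto simp: in_cbox_complex_iff real_of_grid_code field_simps)
    \<comment> \<open>Two points of the closed block differ by at most its side, three cell widths,
      in each coordinate; this gives the constant 6.\<close>
    with assms(1,2) have "dist z z' \<le> 2 * 3 / d"
      by (intro dist_le_of_grid_coordinates) (auto simp: cell_def)
    then show "z' \<in> planar_set k" using assms(3) by simp
  qed
qed (simp_all add: assms real_of_grid_code divide_right_mono)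

lemma cell_subset_block: "cell w d a b \<subseteq> block w d a b"
  by (auto simp: cell_def block_def)

lemma dist_cell_le:
  "0 < d \<Longrightarrow> z \<in> cell w d a b \<Longrightarrow> z' \<in> cell w d a b \<Longrightarrow> dist z z' \<le> 2 / d"
  using dist_le_of_grid_coordinates[of d z z' 1] by (auto simp: cell_def)

text \<open>Points of adjacent cells differ by at most two cell widths in each coordinate. The
  resulting 4 governs the choice of the mesh for certificates.\<close>

lemma dist_adjacent_cells_le:
  assumes "0 < d" "z \<in> cell w d a b" "z' \<in> cell w d a' b'"
    "a \<le> a' + 1" "a' \<le> a + 1" "b \<le> b' + 1" "b' \<le> b + 1"
  shows "dist z z' \<le> 4 / d"
proof -
  have "real a \<le> real a' + 1" "real a' \<le> real a + 1" "real b \<le> real b' + 1" "real b' \<le> real b + 1"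
    using assms(4-) by linarith+
  then show ?thesis using dist_le_of_grid_coordinates[of d z z' 2] assms(1-3) by (auto simp: cell_def)
qed

lemma nat_subdivision:
  fixes t :: real
  assumes "0 \<le> t" "t \<le> real s" "0 < s"
  shows "\<exists>c<s. real c \<le> t \<and> t \<le> real c + 1"
proof (cases "t = s")
  case True
  \<comment> \<open>The right end goes to the last interval, since its floor \<open>s\<close> is out
    of range.\<close>
  then show ?thesis using assms by (intro exI[of _ "s - 1"]) (auto simp: of_nat_diff)
next
  case False
  then show ?thesis using assms by (intro exI[of _ "nat \<lfloor>t\<rfloor>"]) (auto simp: nat_less_iff floor_less_iff)
qed

lemma ball_covered_by_cells:
  assumes "z \<in> ball 0 (real M)" "0 < N"
  shows "\<exists>a<2 * (M * N). \<exists>b<2 * (M * N). z \<in> cell (M * N) N a b"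
proof -
  have *: "\<exists>c<2 * (M * N). real c \<le> x * N + real (M * N) \<and> x * N + real (M * N) \<le> real c + 1"
    if x: "\<bar>x\<bar> < M" for x :: real
  proof (rule nat_subdivision)
    have "\<bar>x * N\<bar> \<le> M * N" using x assms(2) by (simp add: abs_mult)
    then show "0 \<le> x * N + real (M * N)" "x * N + real (M * N) \<le> real (2 * (M * N))"
      by auto
    show "0 < 2 * (M * N)" using x assms(2) by (cases "M = 0") auto
  qed
  have "\<bar>Re z\<bar> < M" "\<bar>Im z\<bar> < M"
    using assms(1) abs_Re_le_cmod[of z] abs_Im_le_cmod[of z] by auto
  from *[OF this(1)] *[OF this(2)] show ?thesis unfolding cell_def by blast
qed

text \<open>Multiplying \<open>w\<close>, \<open>d\<close> and the indices by \<open>s\<close>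
  divides the mesh by \<open>s\<close> and keeps the origin; \<open>c\<close> and \<open>c'\<close>
  are the offsets of the subcell inside the cell.\<close>

lemma cell_subdivision:
  assumes "z \<in> cell w d a b" "0 < s"
  shows "\<exists>c<s. \<exists>c'<s. z \<in> cell (w * s) (d * s) (a * s + c) (b * s + c')"
proof -
  have *: "\<exists>c<s. real (a * s + c) \<le> x * real (d * s) + real (w * s) \<and>
       x * real (d * s) + real (w * s) \<le> real (a * s + c) + 1"
    if "real a \<le> x * d + w" "x * d + w \<le> real a + 1" for x :: real and a
  proof -
    have "0 \<le> (x * d + w - a) * s" "(x * d + w - a) * s \<le> real s"
      using that mult_right_mono[of "x * d + w - a" 1 s] by auto
    from nat_subdivision[OF this assms(2)] show ?thesis by (auto simp: algebra_simps)
  qed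
  show ?thesis using assms(1) *[of a "Re z"] *[of b "Im z"] unfolding cell_def by blast
qed

lemma subcell_subset:
  assumes "c < s" "c' < s"
  shows "cell (w * s) (d * s) (a * s + c) (b * s + c') \<subseteq> cell w d a b"
proof -
  have *: "real a \<le> x * d + w \<and> x * d + w \<le> real a + 1"
    if "real (a * s + c) \<le> x * real (d * s) + real (w * s)"
       "x * real (d * s) + real (w * s) \<le> real (a * s + c) + 1" "c < s" for x :: real and a c
  proof -
    have "real c + 1 \<le> s" using that(3) by linarith
    then have "real a * s \<le> (x * d + w) * s" "(x * d + w) * s \<le> (real a + 1) * s"
      using that(1,2) by (auto simp: algebra_simps)
    then show ?thesis using that(3) by (auto simp: mult_le_cancel_right)
  qed
  show ?thesis using assms *[of a c] *[of b c'] by (auto simp: cell_def simp del: of_nat_add of_nat_mult)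
qed

lemma subblock_subset:
  assumes "c < s" "c' < s"
  shows "block (w * s) (d * s) (a * s + c) (b * s + c') \<subseteq> block w d a b"
proof -
  have *: "real a - 1 < x * d + w \<and> x * d + w < real a + 2"
    if "real (a * s + c) - 1 < x * real (d * s) + real (w * s)"
       "x * real (d * s) + real (w * s) < real (a * s + c) + 2" "c < s" for x :: real and a c
  proof -
    have "real c + 1 \<le> s" using that(3) by linarith
    then have "(real a - 1) * s < (x * d + w) * s" "(x * d + w) * s < (real a + 2) * s"
      using that(1,2) by (auto simp: algebra_simps)
    then show ?thesis using that(3) by (auto simp: mult_less_cancel_right)
  qed
  show ?thesis using assms *[of a c] *[of b c'] by (auto simp: block_def simp del: of_nat_add of_nat_mult)
qed

lemma cells_meet_adjacent:
  assumes "z \<in> cell w d a b" "z \<in> cell w d a' b'"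
  shows "a \<le> a' + 1 \<and> a' \<le> a + 1 \<and> b \<le> b' + 1 \<and> b' \<le> b + 1"
  using assms unfolding cell_def by auto

text \<open>The strict bounds of \<open>block\<close> matter: a closed block would also touch cells
  two indices away.\<close>

lemma block_meets_adjacent:
  assumes "z \<in> block w d a b" "z \<in> cell w d a' b'"
  shows "a \<le> a' + 1 \<and> a' \<le> a + 1 \<and> b \<le> b' + 1 \<and> b' \<le> b + 1"
  using assms unfolding cell_def block_def by auto

section \<open>Clopen partitions\<close>

lemma connected_subset_clopen:
  assumes "connected C" "C \<subseteq> E" "closedin (top_of_set E) F" "openin (top_of_set E) F"
    "C \<inter> F \<noteq> {}"
  shows "C \<subseteq> F"
proof -
  obtain S T where "closed S" "F = E \<inter> S" "open T" "F = E \<inter> T"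
    using assms(3,4) by (auto simp: closedin_closed openin_open)
  then have "C \<inter> F = C \<inter> S" "C \<inter> F = C \<inter> T" using assms(2) by blast+
  then have "openin (top_of_set C) (C \<inter> F)" "closedin (top_of_set C) (C \<inter> F)"
    using \<open>closed S\<close> \<open>open T\<close> openin_open_Int closedin_closed_Int by metis+
  then show ?thesis using assms(1,5) unfolding connected_clopen by blast
qed

text \<open>The pieces are clopen, so each component lies in exactly one of them, and each piece,
  being nonempty, receives a component. By counting it receives only one, and since the components
  cover the piece it equals that one.\<close>

lemma components_of_clopen_partition:
  fixes F :: "nat \<Rightarrow> 'a::topological_space set"
  assumes fin: "finite (components E)" and n: "card (components E) = n"
    and cl: "\<And>j. j < n \<Longrightarrow> closedin (top_of_set E) (F j)"
    and ne: "\<And>j. j < n \<Longrightarrow> F j \<noteq> {}"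
    and disj: "\<And>i j. i < n \<Longrightarrow> j < n \<Longrightarrow> i \<noteq> j \<Longrightarrow> F i \<inter> F j = {}"
    and un: "(\<Union>j<n. F j) = E"
  shows "bij_betw F {..<n} (components E)"
proof -
  have op: "openin (top_of_set E) (F j)" if "j < n" for j
  proof -
    have "closedin (top_of_set E) (\<Union>i\<in>{..<n} - {j}. F i)"
      by (intro closedin_Union) (auto intro: cl)
    moreover have "F j = topspace (top_of_set E) - (\<Union>i\<in>{..<n} - {j}. F i)"
      using that un disj by fastforce
    ultimately show ?thesis by (metis openin_closedin_eq openin_diff openin_topspace)
  qed
  have "\<exists>j<n. C \<subseteq> F j" if "C \<in> components E" for C
  proof -
    have "C \<noteq> {}" "C \<subseteq> E" using that in_components_nonempty in_components_subset by blast+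
    then obtain j where "j < n" "C \<inter> F j \<noteq> {}" using un by blast
    then show ?thesis
      using connected_subset_clopen[of C E "F j"] cl op that \<open>C \<subseteq> E\<close> in_components_connected
      by blast
  qed
  then obtain \<phi> where \<phi>: "\<And>C. C \<in> components E \<Longrightarrow> \<phi> C < n \<and> C \<subseteq> F (\<phi> C)" by metis
  have memb: "\<exists>C. C \<in> components E \<and> \<phi> C = j \<and> x \<in> C" if "j < n" "x \<in> F j" for j x
  proof -
    have "x \<in> E" using that un by blast
    then obtain C where C: "C \<in> components E" "x \<in> C" using Union_components[of E] by blast
    then show ?thesis using \<phi>[OF C(1)] disj[of "\<phi> C" j] that by blast
  qed
  have surj: "\<phi> ` components E = {..<n}"
  proof
    show "{..<n} \<subseteq> \<phi> ` components E" using memb ne by blast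
  qed (use \<phi> in auto)
  \<comment> \<open>Here it is used that there are exactly as many components as pieces.\<close>
  then have "inj_on \<phi> (components E)" using fin n by (intro eq_card_imp_inj_on) auto
  have F: "F (\<phi> C) = C" if C: "C \<in> components E" for C
  proof
    show "C \<subseteq> F (\<phi> C)" using \<phi> that by blast
    show "F (\<phi> C) \<subseteq> C"
    proof
      fix x assume "x \<in> F (\<phi> C)"
      then obtain C' where "C' \<in> components E" "\<phi> C' = \<phi> C" "x \<in> C'"
        using memb[of "\<phi> C" x] \<phi>[OF C] by blast
      then show "x \<in> C" using \<open>inj_on \<phi> (components E)\<close> that by (auto dest: inj_onD)
    qed
  qed
  show ?thesis
  proof (rule bij_betwI')
    fix i j assume "i \<in> {..<n}" "j \<in> {..<n}"
    then show "F i = F j \<longleftrightarrow> i = j" using ne disj by fastforce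
  next
    fix j assume "j \<in> {..<n}"
    then obtain C where "C \<in> components E" "j = \<phi> C" unfolding surj[symmetric] by blast
    then show "F j \<in> components E" using F by simp
  next
    fix C assume C: "C \<in> components E"
    show "\<exists>j\<in>{..<n}. C = F j"
    proof
      show "C = F (\<phi> C)" using F[OF C] ..
      show "\<phi> C \<in> {..<n}" using \<phi>[OF C] by simp
    qed
  qed
qed

lemma components_separated:
  fixes E :: "complex set"
  assumes "compact E" "finite (components E)"
  obtains \<delta> where "\<delta> > 0"
    "\<And>C C' x y. C \<in> components E \<Longrightarrow> C' \<in> components E \<Longrightarrow> x \<in> C \<Longrightarrow> y \<in> C' \<Longrightarrow> dist x y < \<delta> \<Longrightarrow> C = C'"
proof -
  define I where "I = {(C, C'). C \<in> components E \<and> C' \<in> components E \<and> C \<noteq> C'}"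
  have "I \<subseteq> components E \<times> components E" by (auto simp: I_def)
  then have finI: "finite I" using assms(2) finite_subset by blast
  have "\<exists>d>0. \<forall>x\<in>fst c. \<forall>y\<in>snd c. d \<le> dist x y" if "c \<in> I" for c
  proof -
    have "compact (fst c)" "closed (snd c)" "fst c \<inter> snd c = {}"
      using that assms(1) compact_components[of E] components_nonoverlap[of "fst c" E "snd c"]
      by (auto simp: I_def intro: compact_imp_closed)
    then show ?thesis by (rule separate_compact_closed)
  qed
  then obtain d where d: "\<And>c. c \<in> I \<Longrightarrow> d c > 0"
    "\<And>c x y. c \<in> I \<Longrightarrow> x \<in> fst c \<Longrightarrow> y \<in> snd c \<Longrightarrow> d c \<le> dist x y" by metis
  show ?thesis
  proof
    \<comment> \<open>The extra 1 keeps the minimum defined when there are no two distinct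
      components.\<close>
    show "Min (insert 1 (d ` I)) > 0" using finI d(1) by auto
    fix C C' x y
    assume *: "C \<in> components E" "C' \<in> components E" "x \<in> C" "y \<in> C'"
      "dist x y < Min (insert 1 (d ` I))"
    show "C = C'"
    proof (rule ccontr)
      assume "C \<noteq> C'"
      then have I: "(C, C') \<in> I" using * by (auto simp: I_def)
      then have "Min (insert 1 (d ` I)) \<le> d (C, C')" using finI by auto
      then show False using d(2)[OF I, of x y] * by auto
    qed
  qed
qed

section \<open>Certificates\<close>

definition listed_before :: "(nat \<Rightarrow> nat) \<Rightarrow> nat \<Rightarrow> nat \<Rightarrow> bool" where
  "listed_before f k v \<longleftrightarrow> (\<exists>i<k. f i = Suc v)"

lemma listed_before_imp_listed: "listed_before f k v \<Longrightarrow> v \<in> listed f"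
  by (auto simp: listed_before_def listed_def)

text \<open>The bound is stated for all later \<open>k'\<close> so that several such bounds can be
  merged by taking the maximum.\<close>

lemma finite_listed:
  assumes "finite A" "A \<subseteq> listed f"
  shows "\<exists>k. \<forall>k'\<ge>k. \<forall>v\<in>A. listed_before f k' v"
  using assms
proof (induction A rule: finite_induct)
  case (insert v A)
  then obtain k i where "\<forall>k'\<ge>k. \<forall>v\<in>A. listed_before f k' v" "f i = Suc v" by (auto simp: listed_def)
  then show ?case by (intro exI[of _ "max k (Suc i)"]) (auto simp: listed_before_def Suc_le_eq)
qed simp

text \<open>Since \<open>lnth\<close> gives 0 beyond the end of the list, every number
  \<open>L\<close> is a labelling, and a search over numbers runs through all labellings of finite
  squares.\<close>

definition label :: "nat \<Rightarrow> nat \<Rightarrow> nat \<Rightarrow> nat" where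
  "label L a b = lnth L (prod_encode (a, b))"

lemma label_surj: "\<exists>L. \<forall>a b. label L a b = (if a < G \<and> b < G then f a b else 0)"
proof -
  have "finite (prod_encode ` ({..<G} \<times> {..<G}))" by simp
  then obtain m where "\<forall>i\<in>prod_encode ` ({..<G} \<times> {..<G}). i < m"
    unfolding finite_nat_set_iff_bounded by blast
  then have m: "\<And>a b. a < G \<Longrightarrow> b < G \<Longrightarrow> prod_encode (a, b) < m" by blast
  define L where "L = list_encode
    (map (\<lambda>i. if pi1 i < G \<and> pi2 i < G then f (pi1 i) (pi2 i) else 0) [0..<m])"
  have "label L a b = (if a < G \<and> b < G then f a b else 0)" for a b
    using m[of a b] by (auto simp: label_def L_def lnth_def)
  then show ?thesis by blast
qed

text \<open>An odd code, hence the exterior of the disk of radius \<open>M\<close>. Its being listed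
  for the domain confines \<open>E\<close> to the square covered by the grid.\<close>

definition ext_code :: "nat \<Rightarrow> nat" where
  "ext_code M = Suc (2 * grid_code 0 1 M)"

lemma closure_ext_code: "closure (planar_set (ext_code M)) = - ball 0 (real M)"
proof -
  have "odd (ext_code M)" "ext_code M div 2 = grid_code 0 1 M" by (simp_all add: ext_code_def)
  then show ?thesis
    unfolding planar_set_odd[OF \<open>odd (ext_code M)\<close>] closure_complement interior_cball
    by (simp add: real_of_grid_code)
qed

text \<open>The input track \<open>g\<close> interleaves the name of the domain, the name of its boundary, and the
  number \<open>n\<close> of components.  A certificate labels the cells of the grid of mesh \<open>1 / N\<close> in the
  square \<open>[-M, M]\<^sup>2\<close>: label 0 marks cells known to lie in the domain, label \<open>Suc j\<close> marks the cells
  around the component \<open>j\<close>.  All verifications use the first \<open>k\<close> symbols of the input only.\<close>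

definition certificate :: "(nat \<Rightarrow> nat) \<Rightarrow> nat \<Rightarrow> nat \<Rightarrow> nat \<Rightarrow> nat \<Rightarrow> bool" where
  "certificate g N M L k \<longleftrightarrow> 0 < N \<and> listed_before (\<lambda>i. pi1 (g i)) k (ext_code M) \<and>
    (\<forall>a<2 * (M * N). \<forall>b<2 * (M * N).
       label L a b \<le> pi2 (pi2 (g 0)) \<and>
       (label L a b = 0 \<longrightarrow> listed_before (\<lambda>i. pi1 (g i)) k (cell_code (M * N) N a b)) \<and>
       (\<forall>a'<2 * (M * N). \<forall>b'<2 * (M * N).
          a \<le> a' + 1 \<and> a' \<le> a + 1 \<and> b \<le> b' + 1 \<and> b' \<le> b + 1 \<longrightarrow>
          label L a b \<noteq> 0 \<longrightarrow> label L a' b' \<noteq> 0 \<longrightarrow> label L a b = label L a' b')) \<and>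
    (\<forall>j<pi2 (pi2 (g 0)). \<exists>a<2 * (M * N). \<exists>b<2 * (M * N).
       label L a b = Suc j \<and> listed_before (\<lambda>i. pi1 (pi2 (g i))) k (block_code (M * N) N a b))"

text \<open>The condition \<open>0 < s\<close> excludes vacuous acceptance for want of
  subcells.\<close>

definition misses_piece :: "(nat \<Rightarrow> nat) \<Rightarrow> nat \<Rightarrow> nat \<Rightarrow> nat \<Rightarrow> nat \<Rightarrow> nat \<Rightarrow> nat \<Rightarrow> nat \<Rightarrow> bool" where
  "misses_piece g N M L j B s k \<longleftrightarrow> 0 < s \<and>
    (\<forall>a<2 * (M * N). \<forall>b<2 * (M * N). label L a b = Suc j \<longrightarrow>
      (\<forall>c<s. \<forall>c'<s.
         listed_before (\<lambda>i. pi1 (g i)) k (cell_code (M * N * s) (N * s) (a * s + c) (b * s + c')) \<or>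
         separated (grid_code (M * N * s) (N * s) (a * s + c))
                   (grid_code (M * N * s) (N * s) (Suc (a * s + c)))
                   (grid_code (M * N * s) (N * s) (b * s + c'))
                   (grid_code (M * N * s) (N * s) (Suc (b * s + c'))) B))"

text \<open>The test \<open>inside\<close> is applied to the closed rectangle spanned by the block,
  which is slightly more than inclusion of the open block; a finer grid makes up for the
  difference.\<close>

definition meets_boundary :: "(nat \<Rightarrow> nat) \<Rightarrow> nat \<Rightarrow> nat \<Rightarrow> nat \<Rightarrow> nat \<Rightarrow> nat \<Rightarrow> nat \<Rightarrow> nat \<Rightarrow> bool" where
  "meets_boundary g N M L j B s k \<longleftrightarrow> 0 < s \<and>
    (\<exists>a<2 * (M * N). \<exists>b<2 * (M * N). label L a b = Suc j \<and>
      (\<exists>c<s. \<exists>c'<s.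
         listed_before (\<lambda>i. pi1 (pi2 (g i))) k (block_code (M * N * s) (N * s) (a * s + c) (b * s + c')) \<and>
         inside (grid_code (Suc (M * N * s)) (N * s) (a * s + c))
                (grid_code (M * N * s) (N * s) (a * s + c + 2))
                (grid_code (Suc (M * N * s)) (N * s) (b * s + c'))
                (grid_code (M * N * s) (N * s) (b * s + c' + 2)) B))"

definition piece :: "complex set \<Rightarrow> nat \<Rightarrow> nat \<Rightarrow> nat \<Rightarrow> nat \<Rightarrow> complex set" where
  "piece E N M L j = E \<inter> \<Union>{cell (M * N) N a b | a b.
     a < 2 * (M * N) \<and> b < 2 * (M * N) \<and> label L a b = Suc j}"

section \<open>Compact planar sets with finitely many components\<close>

locale planar_input =
  fixes E :: "complex set" and p q :: "nat \<Rightarrow> nat" and n :: nat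
  assumes compact: "compact E" and finite_components: "finite (components E)"
    and card_components: "card (components E) = n"
    and listed_p: "listed p = {k. closure (planar_set k) \<inter> E = {}}"
    and listed_q: "listed q = {k. planar_set k \<inter> frontier E \<noteq> {}}"
begin

lemma input3_simps [simp]: "pi1 (input3 p q n i) = p i" "pi1 (pi2 (input3 p q n i)) = q i"
  "pi2 (pi2 (input3 p q n i)) = n"
  by (simp_all add: input3_def)

lemma frontier_subset: "frontier E \<subseteq> E"
  using compact by (simp add: compact_imp_closed frontier_subset_closed)

lemma listed_cell: "0 < d \<Longrightarrow> listed_before p k (cell_code w d a b) \<Longrightarrow> cell w d a b \<inter> E = {}"
  using listed_before_imp_listed[of p k "cell_code w d a b"] listed_p by (simp add: closure_cell_code)

lemma listed_block: "0 < d \<Longrightarrow> listed_before q k (block_code w d a b) \<Longrightarrow> block w d a b \<inter> frontier E \<noteq> {}"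
  using listed_before_imp_listed[of q k "block_code w d a b"] listed_q by (simp add: planar_set_block_code)

text \<open>If 4 times the mesh is below the mutual distance \<delta> of the components, a cell
  together with its neighbours meets at most one component, and that component is its label. Only
  finitely many facts have to be listed, so some prefix shows them all.\<close>

lemma certificate_exists: "\<exists>N M L k. certificate (input3 p q n) N M L k"
proof -
  obtain \<delta> where \<delta>: "\<delta> > 0" "\<And>C C' x y. C \<in> components E \<Longrightarrow> C' \<in> components E \<Longrightarrow>
      x \<in> C \<Longrightarrow> y \<in> C' \<Longrightarrow> dist x y < \<delta> \<Longrightarrow> C = C'"
    using components_separated[OF compact finite_components] by blast
  obtain K where K: "bij_betw K {..<n} (components E)"
    using finite_components card_components ex_bij_betw_nat_finite
    by (metis atLeast0LessThan)
  have K_comp: "K j \<in> components E" if "j < n" for j using K that by (auto simp: bij_betw_def)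
  have K_inj: "i = j" if "i < n" "j < n" "K i = K j" for i j
    using K that by (auto simp: bij_betw_def inj_on_def)
  have K_un: "\<exists>j<n. x \<in> K j" if "x \<in> E" for x
  proof -
    have "x \<in> \<Union>(components E)" using that by simp
    then show ?thesis using K unfolding bij_betw_def by blast
  qed
  have K_close: "i = j" if "i < n" "j < n" "x \<in> K i" "y \<in> K j" "dist x y < \<delta>" for i j x y
    using \<delta>(2)[OF K_comp K_comp] that K_inj by blast
  obtain M :: nat where M: "E \<subseteq> ball 0 (real M)"
  proof -
    obtain B where "\<And>x. x \<in> E \<Longrightarrow> norm x \<le> B"
      using compact compact_imp_bounded bounded_iff by metis
    moreover obtain M :: nat where "B < M" using reals_Archimedean2 by blast
    ultimately show ?thesis by (intro that[of M]) force
  qed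
  obtain N :: nat where N: "0 < N" "4 / N < \<delta>"
  proof -
    obtain N :: nat where "4 / \<delta> < N" using reals_Archimedean2 by blast
    moreover from this have "0 < N" using \<delta>(1) by (cases N) (auto simp: field_simps)
    ultimately show ?thesis using \<delta>(1) by (intro that[of N]) (auto simp: field_simps)
  qed
  define G where "G = 2 * (M * N)"
  let ?cell = "cell (M * N) N"
  \<comment> \<open>The choice is only apparent: by the size of the mesh, \<open>f_eq\<close> shows
    that the index is unique.\<close>
  define f where "f a b = (if ?cell a b \<inter> E = {} then 0 else
    Suc (SOME j. j < n \<and> ?cell a b \<inter> K j \<noteq> {}))" for a b
  have f_Suc: "\<exists>j<n. f a b = Suc j \<and> ?cell a b \<inter> K j \<noteq> {}" if "f a b \<noteq> 0" for a b
  proof -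
    have ne: "?cell a b \<inter> E \<noteq> {}" using that by (auto simp: f_def)
    then have "\<exists>j. j < n \<and> ?cell a b \<inter> K j \<noteq> {}" using K_un by blast
    then show ?thesis using someI_ex[of "\<lambda>j. j < n \<and> ?cell a b \<inter> K j \<noteq> {}"] ne
      by (auto simp: f_def)
  qed
  have f_eq: "f a b = Suc j" if "j < n" "z \<in> ?cell a b" "z \<in> K j" for a b z j
  proof -
    have "z \<in> E" using K_comp[OF that(1)] in_components_subset that(3) by blast
    then have "f a b \<noteq> 0" using that(2) by (auto simp: f_def)
    then obtain i z' where i: "i < n" "f a b = Suc i" "z' \<in> ?cell a b" "z' \<in> K i"
      using f_Suc by blast
    have "dist z' z < \<delta>" using dist_adjacent_cells_le[OF N(1) i(3) that(2)] N(2) by auto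
    then show ?thesis using K_close i that by blast
  qed
  obtain L where L: "\<And>a b. label L a b = (if a < G \<and> b < G then f a b else 0)"
    using label_surj by metis
  \<comment> \<open>Every component must be seen through the boundary of \<open>E\<close>, so it has
    to contain a frontier point of \<open>E\<close> itself. A frontier point of the component
    serves: it exists because the component is compact and nonempty in the plane.\<close>
  have fr: "\<exists>z. z \<in> K j \<and> z \<in> frontier E" if "j < n" for j
  proof -
    have comp: "compact (K j)" "K j \<noteq> {}" "K j \<subseteq> E"
      using compact compact_components K_comp[OF that] in_components_nonempty in_components_subset
      by blast+
    have "K j \<noteq> UNIV" using comp(1) not_bounded_UNIV compact_imp_bounded by metis
    then have "frontier (K j) \<noteq> {}" using comp(2) frontier_eq_empty by blast
    then obtain z where z: "z \<in> frontier (K j)" by blast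
    then have zK: "z \<in> K j" using comp(1) frontier_subset_closed compact_imp_closed by blast
    have "z \<notin> interior E"
    proof
      assume "z \<in> interior E"
      then obtain e where e: "e > 0" "ball z e \<subseteq> E" by (auto simp: mem_interior)
      \<comment> \<open>Points of \<open>E\<close> within \<delta> of \<open>z\<close> belong to the
        component of \<open>z\<close>, so an interior point of \<open>E\<close> in
        \<open>K j\<close> is interior to \<open>K j\<close>.\<close>
      have "ball z (min e \<delta>) \<subseteq> K j"
      proof
        fix y assume y: "y \<in> ball z (min e \<delta>)"
        then have "y \<in> E" using e(2) by auto
        then obtain i where "i < n" "y \<in> K i" using K_un by blast
        then show "y \<in> K j" using K_close[of j i z y] y that zK by auto
      qed
      then have "z \<in> interior (K j)" using e(1) \<delta>(1) by (auto simp: mem_interior intro!: exI[of _ "min e \<delta>"])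
      then show False using z by (simp add: frontier_def)
    qed
    then show ?thesis using zK comp(3) closure_subset by (auto simp: frontier_def)
  qed
  define S where "S = {(a, b). a < G \<and> b < G \<and> f a b = 0}"
  define V where "V = insert (ext_code M) ((\<lambda>(a, b). cell_code (M * N) N a b) ` S)"
  have "finite S" by (rule finite_subset[of _ "{..<G} \<times> {..<G}"]) (auto simp: S_def)
  then have "finite V" by (simp add: V_def)
  moreover have "V \<subseteq> listed p"
    using M N(1)
    by (auto simp: V_def S_def listed_p closure_cell_code closure_ext_code f_def split: if_splits)
  ultimately obtain k1 where k1': "\<And>k' v. k1 \<le> k' \<Longrightarrow> v \<in> V \<Longrightarrow> listed_before p k' v"
    using finite_listed by meson
  have k1: "listed_before p k' (ext_code M)"
    "a < G \<Longrightarrow> b < G \<Longrightarrow> f a b = 0 \<Longrightarrow> listed_before p k' (cell_code (M * N) N a b)"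
    if "k1 \<le> k'" for k' a b
    using k1'[OF that] by (auto simp: V_def S_def)
  have "\<exists>a b. a < G \<and> b < G \<and> f a b = Suc j \<and> block_code (M * N) N a b \<in> listed q" if j: "j < n" for j
  proof -
    obtain z where z: "z \<in> K j" "z \<in> frontier E" using fr[OF j] by blast
    then have "z \<in> ball 0 (real M)" using M frontier_subset by blast
    then obtain a b where ab: "a < G" "b < G" "z \<in> ?cell a b"
      using ball_covered_by_cells[OF _ N(1)] unfolding G_def by blast
    then have "z \<in> block (M * N) N a b" using cell_subset_block by blast
    then show ?thesis using ab f_eq[OF j ab(3) z(1)] z(2)
      by (auto simp: listed_q planar_set_block_code N(1))
  qed
  then obtain A B where AB: "\<And>j. j < n \<Longrightarrow> A j < G \<and> B j < G \<and> f (A j) (B j) = Suc j \<and>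
      block_code (M * N) N (A j) (B j) \<in> listed q" by metis
  obtain k2 where k2: "\<And>k' j. k2 \<le> k' \<Longrightarrow> j < n \<Longrightarrow> listed_before q k' (block_code (M * N) N (A j) (B j))"
    using finite_listed[of "(\<lambda>j. block_code (M * N) N (A j) (B j)) ` {..<n}" q] AB by blast
  have "certificate (input3 p q n) N M L (max k1 k2)"
    unfolding certificate_def G_def[symmetric] input3_simps
  proof (intro conjI allI impI)
    show "0 < N" by (fact N(1))
    show "listed_before p (max k1 k2) (ext_code M)" using k1(1) by simp
  next
    fix a b assume ab: "a < G" "b < G"
    show "label L a b \<le> n" using f_Suc[of a b] by (cases "f a b = 0") (auto simp: L)
    show "listed_before p (max k1 k2) (cell_code (M * N) N a b)" if "label L a b = 0"
      using k1(2) ab that by (simp add: L)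
    fix a' b' assume ab': "a' < G" "b' < G" and
      adj: "a \<le> a' + 1 \<and> a' \<le> a + 1 \<and> b \<le> b' + 1 \<and> b' \<le> b + 1"
      and nz: "label L a b \<noteq> 0" "label L a' b' \<noteq> 0"
    have "f a b \<noteq> 0" "f a' b' \<noteq> 0" using nz ab ab' by (simp_all add: L)
    then obtain i z i' z' where i: "i < n" "f a b = Suc i" "z \<in> ?cell a b" "z \<in> K i"
      and i': "i' < n" "f a' b' = Suc i'" "z' \<in> ?cell a' b'" "z' \<in> K i'"
      using f_Suc by (metis disjoint_iff)
    have "dist z z' < \<delta>" using dist_adjacent_cells_le[OF N(1) i(3) i'(3)] adj N(2) by auto
    then have "i = i'" using K_close i i' by blast
    then show "label L a b = label L a' b'" using i i' ab ab' by (simp add: L)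
  next
    fix j assume "j < n"
    then show "\<exists>a<G. \<exists>b<G. label L a b = Suc j \<and> listed_before q (max k1 k2) (block_code (M * N) N a b)"
      using AB[of j] k2[of "max k1 k2" j] by (intro exI[of _ "A j"] conjI exI[of _ "B j"]) (auto simp: L)
  qed
  then show ?thesis by blast
qed

section \<open>Consequences of a valid certificate\<close>

context
  fixes N M L k
  assumes cert: "certificate (input3 p q n) N M L k"
begin

lemma N_pos: "0 < N"
  using cert by (simp add: certificate_def)

lemma E_bounded: "E \<subseteq> ball 0 (real M)"
proof -
  have "listed_before p k (ext_code M)" using cert by (simp add: certificate_def)
  then have "closure (planar_set (ext_code M)) \<inter> E = {}"
    using listed_before_imp_listed listed_p by blast
  then show ?thesis unfolding closure_ext_code by blast
qed

lemma cert_zero: "a < 2 * (M * N) \<Longrightarrow> b < 2 * (M * N) \<Longrightarrow> label L a b = 0 \<Longrightarrow> cell (M * N) N a b \<inter> E = {}"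
  using cert listed_cell[OF N_pos, of k] unfolding certificate_def input3_simps by blast

lemma cert_le: "a < 2 * (M * N) \<Longrightarrow> b < 2 * (M * N) \<Longrightarrow> label L a b \<le> n"
  using cert unfolding certificate_def input3_simps by blast

lemma cert_adjacent:
  "a < 2 * (M * N) \<Longrightarrow> b < 2 * (M * N) \<Longrightarrow> a' < 2 * (M * N) \<Longrightarrow> b' < 2 * (M * N) \<Longrightarrow>
   a \<le> a' + 1 \<and> a' \<le> a + 1 \<and> b \<le> b' + 1 \<and> b' \<le> b + 1 \<Longrightarrow>
   label L a b \<noteq> 0 \<Longrightarrow> label L a' b' \<noteq> 0 \<Longrightarrow> label L a b = label L a' b'"
  using cert unfolding certificate_def by blast

lemma cell_of_point:
  assumes "z \<in> E"
  obtains a b j where "a < 2 * (M * N)" "b < 2 * (M * N)" "z \<in> cell (M * N) N a b" "j < n"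
    "label L a b = Suc j"
proof -
  obtain a b where ab: "a < 2 * (M * N)" "b < 2 * (M * N)" "z \<in> cell (M * N) N a b"
    using ball_covered_by_cells[OF _ N_pos] E_bounded assms by blast
  then have "label L a b \<noteq> 0" "label L a b \<le> n" using cert_zero cert_le assms by blast+
  then show ?thesis using that[OF ab] by (cases "label L a b") (auto simp: Suc_le_eq)
qed

text \<open>A point of \<open>E\<close> in the block lies in some cell with nonzero label, and that
  cell is adjacent to the central one, so the labels agree. Thus a boundary point found in a block
  is assigned to a piece without knowing its cell.\<close>

lemma block_subset_piece:
  assumes ab: "a < 2 * (M * N)" "b < 2 * (M * N)" "label L a b = Suc j"
  shows "block (M * N) N a b \<inter> E \<subseteq> piece E N M L j"
proof
  fix z assume z: "z \<in> block (M * N) N a b \<inter> E"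
  then obtain a' b' j' where ab': "a' < 2 * (M * N)" "b' < 2 * (M * N)"
    "z \<in> cell (M * N) N a' b'" "label L a' b' = Suc j'"
    using cell_of_point by blast
  then have "label L a b = label L a' b'"
    using z ab block_meets_adjacent[of z] by (intro cert_adjacent) auto
  then show "z \<in> piece E N M L j" using ab ab' z unfolding piece_def by auto
qed

lemma piece_subset: "piece E N M L j \<subseteq> E"
  by (auto simp: piece_def)

lemma closed_piece: "closed (piece E N M L j)"
proof -
  have "{cell (M * N) N a b | a b. a < 2 * (M * N) \<and> b < 2 * (M * N) \<and> label L a b = Suc j} \<subseteq>
    (\<lambda>(a, b). cell (M * N) N a b) ` ({..<2 * (M * N)} \<times> {..<2 * (M * N)})" by auto
  then have "finite {cell (M * N) N a b | a b. a < 2 * (M * N) \<and> b < 2 * (M * N) \<and> label L a b = Suc j}"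
    by (rule finite_subset) auto
  then show ?thesis unfolding piece_def
    by (intro closed_Int closed_Union compact_imp_closed[OF compact])
       (auto simp: cell_eq_cbox[OF N_pos])
qed

lemma disjoint_pieces: "i \<noteq> j \<Longrightarrow> piece E N M L i \<inter> piece E N M L j = {}"
proof (rule ccontr)
  assume "i \<noteq> j" "piece E N M L i \<inter> piece E N M L j \<noteq> {}"
  then obtain z a b a' b' where "z \<in> cell (M * N) N a b" "z \<in> cell (M * N) N a' b'"
    "a < 2 * (M * N)" "b < 2 * (M * N)" "label L a b = Suc i"
    "a' < 2 * (M * N)" "b' < 2 * (M * N)" "label L a' b' = Suc j"
    by (auto simp: piece_def)
  moreover from this have "label L a b = label L a' b'"
    using cells_meet_adjacent[of z] by (intro cert_adjacent) auto
  ultimately show False using \<open>i \<noteq> j\<close> by simp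
qed

lemma Union_pieces: "(\<Union>j<n. piece E N M L j) = E"
proof
  show "E \<subseteq> (\<Union>j<n. piece E N M L j)"
  proof
    fix z assume "z \<in> E"
    then show "z \<in> (\<Union>j<n. piece E N M L j)"
    proof (rule cell_of_point)
      fix a b j assume "a < 2 * (M * N)" "b < 2 * (M * N)" "z \<in> cell (M * N) N a b" "j < n"
        "label L a b = Suc j"
      then have "z \<in> piece E N M L j" using \<open>z \<in> E\<close> unfolding piece_def by blast
      then show ?thesis using \<open>j < n\<close> by blast
    qed
  qed
qed (use piece_subset in auto)

lemma piece_nonempty:
  assumes "j < n" shows "piece E N M L j \<noteq> {}"
proof -
  obtain a b where ab: "a < 2 * (M * N)" "b < 2 * (M * N)" "label L a b = Suc j"
    "listed_before q k (block_code (M * N) N a b)"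
    using cert assms by (auto simp: certificate_def)
  then show ?thesis using listed_block[OF N_pos ab(4)] block_subset_piece[OF ab(1-3)] frontier_subset
    by blast
qed

lemma pieces_bij: "bij_betw (piece E N M L) {..<n} (components E)"
  using finite_components card_components
  by (rule components_of_clopen_partition)
     (auto intro!: closed_subset piece_subset closed_piece piece_nonempty Union_pieces
       simp: disjoint_pieces)

text \<open>The other pieces form a closed set \<open>R\<close> disjoint from this one. Removing it
  from the interior of \<open>E\<close> leaves an open subset of the piece, so interiors, and with
  them frontiers, are inherited from \<open>E\<close>.\<close>

lemma frontier_piece:
  assumes "j < n"
  shows "frontier (piece E N M L j) = frontier E \<inter> piece E N M L j"
proof -
  define R where "R = (\<Union>i\<in>{..<n} - {j}. piece E N M L i)"
  have "closed R" unfolding R_def by (intro closed_UN) (auto intro: closed_piece)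
  have un: "E = piece E N M L j \<union> R" using Union_pieces assms by (auto simp: R_def)
  have "piece E N M L j \<inter> piece E N M L i = {}" if "i \<in> {..<n} - {j}" for i
    using that disjoint_pieces[of j i] by auto
  then have disj: "piece E N M L j \<inter> R = {}" unfolding R_def by blast
  have "interior (piece E N M L j) = interior E \<inter> piece E N M L j"
  proof
    show "interior (piece E N M L j) \<subseteq> interior E \<inter> piece E N M L j"
      using interior_mono[OF piece_subset] interior_subset by blast
    have "interior E \<inter> piece E N M L j = interior E - R"
      using un disj interior_subset[of E] by blast
    moreover have "open (interior E - R)" using \<open>closed R\<close> by (simp add: open_Diff)
    ultimately show "interior E \<inter> piece E N M L j \<subseteq> interior (piece E N M L j)"
      by (metis inf_le2 interior_maximal)
  qed
  then show ?thesis
    using closed_piece[of j] compact_imp_closed[OF compact] piece_subset[of j]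
    by (auto simp: frontier_def)
qed

lemma misses_piece_sound:
  assumes "misses_piece (input3 p q n) N M L j B s k'"
  shows "closure (planar_set B) \<inter> piece E N M L j = {}"
proof (rule ccontr)
  assume "\<not> ?thesis"
  then obtain z a b where z: "z \<in> closure (planar_set B)" "z \<in> E" "z \<in> cell (M * N) N a b"
    and ab: "a < 2 * (M * N)" "b < 2 * (M * N)" "label L a b = Suc j"
    by (auto simp: piece_def)
  have s: "0 < s" using assms by (simp add: misses_piece_def)
  then have d: "0 < N * s" using N_pos by simp
  obtain c c' where c: "c < s" "c' < s" "z \<in> cell (M * N * s) (N * s) (a * s + c) (b * s + c')"
    using cell_subdivision[OF z(3) s] by blast
  have "listed_before p k' (cell_code (M * N * s) (N * s) (a * s + c) (b * s + c')) \<or>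
     cell (M * N * s) (N * s) (a * s + c) (b * s + c') \<inter> closure (planar_set B) = {}"
    using assms ab c(1,2) unfolding misses_piece_def input3_simps separated_cell_iff[OF d] by blast
  then show False using listed_cell[OF d] c(3) z by blast
qed

text \<open>The compact piece has positive distance \<delta> from the closure of the basic set. A
  sufficiently small subcell that meets \<open>E\<close> contains a point of the piece and so stays
  off the closure; the remaining subcells miss \<open>E\<close> and are listed eventually.\<close>

lemma misses_piece_complete:
  assumes "closure (planar_set B) \<inter> piece E N M L j = {}"
  shows "\<exists>s k. \<forall>k'\<ge>k. misses_piece (input3 p q n) N M L j B s k'"
proof -
  have "compact (piece E N M L j)"
    using closed_piece piece_subset compact by (metis compact_Int_closed inf.absorb_iff2)
  then obtain \<delta> where \<delta>: "\<delta> > 0" "\<And>x y. x \<in> piece E N M L j \<Longrightarrow> y \<in> closure (planar_set B) \<Longrightarrow> \<delta> \<le> dist x y"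
    using separate_compact_closed[of "piece E N M L j" "closure (planar_set B)"] assms by blast
  \<comment> \<open>Two points of a subcell are at distance at most \<open>2 / (N * s)\<close>, by
    \<open>dist_cell_le\<close>.\<close>
  obtain s :: nat where s: "2 / \<delta> < s" using reals_Archimedean2 by blast
  then have s0: "0 < s" using \<delta>(1) by (cases s) (auto simp: field_simps)
  then have d: "0 < N * s" using N_pos by simp
  have "2 / real (N * s) \<le> 2 / s" using N_pos s0 by (intro divide_left_mono) auto
  also have "2 / s < \<delta>" using s s0 \<delta>(1) by (simp add: field_simps)
  finally have small: "2 / real (N * s) < \<delta>" .
  let ?cell = "\<lambda>(a, b). cell (M * N * s) (N * s) a b"
  let ?code = "\<lambda>(a, b). cell_code (M * N * s) (N * s) a b"
  \<comment> \<open>All subcells of the square that miss \<open>E\<close>, whatever their label: a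
    finite set, so one prefix length serves for all.\<close>
  let ?A = "{x \<in> {..<2 * (M * N) * s} \<times> {..<2 * (M * N) * s}. ?cell x \<inter> E = {}}"
  have "?code ` ?A \<subseteq> listed p" by (auto simp: listed_p closure_cell_code[OF d])
  moreover have "finite (?code ` ?A)" by (intro finite_imageI finite_Collect_conjI) auto
  ultimately obtain k1 where k1: "\<And>k' x. k1 \<le> k' \<Longrightarrow> x \<in> ?A \<Longrightarrow> listed_before p k' (?code x)"
    using finite_listed[of "?code ` ?A" p] by blast
  have "misses_piece (input3 p q n) N M L j B s k'" if "k1 \<le> k'" for k'
    unfolding misses_piece_def input3_simps separated_cell_iff[OF d]
  proof (intro conjI allI impI s0)
    fix a b c c' assume ab: "a < 2 * (M * N)" "b < 2 * (M * N)" "label L a b = Suc j" "c < s" "c' < s"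
    have lt: "x * s + y < G * s" if "x < G" "y < s" for x y G
    proof -
      have "x * s + y < (x + 1) * s" using that by simp
      also have "\<dots> \<le> G * s" using that by (intro mult_le_mono1) auto
      finally show ?thesis .
    qed
    show "listed_before p k' (cell_code (M * N * s) (N * s) (a * s + c) (b * s + c')) \<or>
       cell (M * N * s) (N * s) (a * s + c) (b * s + c') \<inter> closure (planar_set B) = {}"
    proof (cases "cell (M * N * s) (N * s) (a * s + c) (b * s + c') \<inter> E = {}")
      case True
      then have "(a * s + c, b * s + c') \<in> ?A" using ab lt by auto
      from k1[OF that this] show ?thesis by simp
    next
      case False
      then obtain z where z: "z \<in> cell (M * N * s) (N * s) (a * s + c) (b * s + c')" "z \<in> E" by blast
      then have "z \<in> piece E N M L j"
        using subcell_subset[OF ab(4,5), of "M * N" N a b] ab unfolding piece_def by blast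
      then show ?thesis using \<delta>(2) dist_cell_le[OF d z(1)] small by force
    qed
  qed
  then show ?thesis by blast
qed

lemma meets_boundary_sound:
  assumes "j < n" "meets_boundary (input3 p q n) N M L j B s k'"
  shows "planar_set B \<inter> frontier (piece E N M L j) \<noteq> {}"
proof -
  obtain a b c c' where s: "0 < s" and ab: "a < 2 * (M * N)" "b < 2 * (M * N)" "label L a b = Suc j"
    and c: "c < s" "c' < s"
    and ls: "listed_before q k' (block_code (M * N * s) (N * s) (a * s + c) (b * s + c'))"
    and ins: "inside (grid_code (Suc (M * N * s)) (N * s) (a * s + c))
                (grid_code (M * N * s) (N * s) (a * s + c + 2))
                (grid_code (Suc (M * N * s)) (N * s) (b * s + c'))
                (grid_code (M * N * s) (N * s) (b * s + c' + 2)) B"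
    using assms(2) unfolding meets_boundary_def input3_simps by blast
  have d: "0 < N * s" using N_pos s by simp
  obtain z where z: "z \<in> block (M * N * s) (N * s) (a * s + c) (b * s + c')" "z \<in> frontier E"
    using listed_block[OF d ls] by blast
  have "z \<in> planar_set B" using block_inside[OF d ins] z(1) by blast
  \<comment> \<open>The point may lie outside the labelled cell, but the small block is contained in
    the large one, all of whose points of \<open>E\<close> belong to the piece.\<close>
  moreover have "z \<in> piece E N M L j"
    using subblock_subset[OF c, of "M * N" N a b] block_subset_piece[OF ab] z frontier_subset by blast
  ultimately show ?thesis using z(2) frontier_piece[OF assms(1)] by blast
qed

lemma meets_boundary_complete:
  assumes "j < n" "planar_set B \<inter> frontier (piece E N M L j) \<noteq> {}"
  shows "\<exists>s k. \<forall>k'\<ge>k. meets_boundary (input3 p q n) N M L j B s k'"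
proof -
  obtain z where z: "z \<in> planar_set B" "z \<in> frontier E" "z \<in> piece E N M L j"
    using assms(2) unfolding frontier_piece[OF assms(1)] by blast
  obtain a b where ab: "a < 2 * (M * N)" "b < 2 * (M * N)" "label L a b = Suc j" "z \<in> cell (M * N) N a b"
    using z(3) by (auto simp: piece_def)
  obtain \<delta> where \<delta>: "\<delta> > 0" "\<And>y. dist z y < \<delta> \<Longrightarrow> y \<in> planar_set B"
    using open_planar_set z(1) by (metis open_dist dist_commute)
  \<comment> \<open>The constant of \<open>inside_of_small_block\<close>: the closed block around
    the subcell of \<open>z\<close> lies within \<open>6 / (N * s)\<close> of
    \<open>z\<close>.\<close>
  obtain s :: nat where s: "6 / \<delta> < s" using reals_Archimedean2 by blast
  then have s0: "0 < s" using \<delta>(1) by (cases s) (auto simp: field_simps)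
  then have d: "0 < N * s" using N_pos by simp
  have "6 / real (N * s) \<le> 6 / s" using N_pos s0 by (intro divide_left_mono) auto
  also have "6 / s < \<delta>" using s s0 \<delta>(1) by (simp add: field_simps)
  finally have small: "6 / real (N * s) < \<delta>" .
  obtain c c' where c: "c < s" "c' < s" "z \<in> cell (M * N * s) (N * s) (a * s + c) (b * s + c')"
    using cell_subdivision[OF ab(4) s0] by blast
  have ins: "inside (grid_code (Suc (M * N * s)) (N * s) (a * s + c))
                (grid_code (M * N * s) (N * s) (a * s + c + 2))
                (grid_code (Suc (M * N * s)) (N * s) (b * s + c'))
                (grid_code (M * N * s) (N * s) (b * s + c' + 2)) B"
    using small \<delta>(2) by (intro inside_of_small_block[OF d c(3)]) auto
  have "block_code (M * N * s) (N * s) (a * s + c) (b * s + c') \<in> listed q"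
    using subsetD[OF cell_subset_block c(3)] z(2) by (auto simp: listed_q planar_set_block_code[OF d])
  then obtain k1 where "\<And>k'. k1 \<le> k' \<Longrightarrow> listed_before q k' (block_code (M * N * s) (N * s) (a * s + c) (b * s + c'))"
    using finite_listed[of "{block_code (M * N * s) (N * s) (a * s + c) (b * s + c')}" q] by auto
  then show ?thesis
    unfolding meets_boundary_def input3_simps using s0 ab(1-3) c(1,2) ins by blast
qed

end

end

section \<open>The machine\<close>

lemma total_recursive_grid_code:
  assumes "total_recursive w" "total_recursive d" "total_recursive u"
  shows "total_recursive (\<lambda>x. grid_code (w x) (d x) (u x))"
proof -
  \<comment> \<open>Nonnegative integers have even codes, and the negative of a positive
    \<open>m\<close> has the odd code \<open>2 * (m - 1) + 1\<close>.\<close>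
  have "int_encode (int a - int b) = (if b \<le> a then 2 * (a - b) else Suc (2 * (b - a - 1)))" for a b
    by (auto simp: int_encode_def sum_encode_def nat_diff_distrib simp flip: of_nat_diff)
  then show ?thesis unfolding grid_code_def
    by (simp only:) (intro recursive_intros assms)
qed

lemma total_recursive_rect_code:
  "total_recursive a \<Longrightarrow> total_recursive b \<Longrightarrow> total_recursive c \<Longrightarrow> total_recursive d \<Longrightarrow>
   total_recursive (\<lambda>x. rect_code (a x) (b x) (c x) (d x))"
  unfolding rect_code_def by (intro recursive_intros)

lemma total_recursive_cell_code:
  "total_recursive w \<Longrightarrow> total_recursive d \<Longrightarrow> total_recursive a \<Longrightarrow> total_recursive b \<Longrightarrow>
   total_recursive (\<lambda>x. cell_code (w x) (d x) (a x) (b x))"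
  unfolding cell_code_def
  by (intro recursive_intros total_recursive_rect_code total_recursive_grid_code)

lemma total_recursive_block_code:
  "total_recursive w \<Longrightarrow> total_recursive d \<Longrightarrow> total_recursive a \<Longrightarrow> total_recursive b \<Longrightarrow>
   total_recursive (\<lambda>x. block_code (w x) (d x) (a x) (b x))"
  unfolding block_code_def
  by (intro recursive_intros total_recursive_rect_code total_recursive_grid_code)

lemma total_recursive_ext_code:
  "total_recursive M \<Longrightarrow> total_recursive (\<lambda>x. ext_code (M x))"
  unfolding ext_code_def by (intro recursive_intros total_recursive_grid_code)

lemma total_recursive_label:
  "total_recursive L \<Longrightarrow> total_recursive a \<Longrightarrow> total_recursive b \<Longrightarrow>
   total_recursive (\<lambda>x. label (L x) (a x) (b x))"
  unfolding label_def by (intro recursive_intros)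

lemma rat_recursive_clamp0:
  "rat_recursive f \<Longrightarrow> rat_recursive g \<Longrightarrow> rat_recursive (\<lambda>x. clamp0 (f x) (g x))"
  unfolding clamp0_def by (intro recursive_intros)

lemma decidable_separated:
  "total_recursive l1 \<Longrightarrow> total_recursive h1 \<Longrightarrow> total_recursive l2 \<Longrightarrow> total_recursive h2 \<Longrightarrow>
   total_recursive k \<Longrightarrow> decidable (\<lambda>x. separated (l1 x) (h1 x) (l2 x) (h2 x) (k x))"
  unfolding separated_def by (intro recursive_intros)

lemma decidable_inside:
  "total_recursive l1 \<Longrightarrow> total_recursive h1 \<Longrightarrow> total_recursive l2 \<Longrightarrow> total_recursive h2 \<Longrightarrow>
   total_recursive k \<Longrightarrow> decidable (\<lambda>x. inside (l1 x) (h1 x) (l2 x) (h2 x) (k x))"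
  unfolding inside_def by (intro recursive_intros rat_recursive_clamp0)

lemma decidable_listed_before:
  assumes t: "total_recursive t" and k: "total_recursive k" and v: "total_recursive v"
  shows "decidable (\<lambda>x. listed_before (\<lambda>i. pi1 (lnth (t x) i)) (k x) (v x))"
    and "decidable (\<lambda>x. listed_before (\<lambda>i. pi1 (pi2 (lnth (t x) i))) (k x) (v x))"
  unfolding listed_before_def
  by (intro recursive_intros total_recursive_comp[OF t] total_recursive_comp[OF v] k)+

lemmas code_intros = recursive_intros total_recursive_grid_code total_recursive_cell_code
  total_recursive_block_code total_recursive_ext_code total_recursive_label
  decidable_separated decidable_inside decidable_listed_before

lemma decidable_certificate:
  assumes "total_recursive t" "total_recursive N" "total_recursive M" "total_recursive L"
    "total_recursive k"
  shows "decidable (\<lambda>x. certificate (lnth (t x)) (N x) (M x) (L x) (k x))"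
  unfolding certificate_def
  \<comment> \<open>Below a quantifier the arguments depend on a projection of a longer context; the
    composed assumptions cover these occurrences.\<close>
  by (intro code_intros assms assms[THEN total_recursive_comp])

lemma decidable_misses_piece:
  assumes "total_recursive t" "total_recursive N" "total_recursive M" "total_recursive L"
    "total_recursive j" "total_recursive B" "total_recursive s" "total_recursive k"
  shows "decidable (\<lambda>x. misses_piece (lnth (t x)) (N x) (M x) (L x) (j x) (B x) (s x) (k x))"
  unfolding misses_piece_def
  by (intro code_intros assms assms[THEN total_recursive_comp])

lemma decidable_meets_boundary:
  assumes "total_recursive t" "total_recursive N" "total_recursive M" "total_recursive L"
    "total_recursive j" "total_recursive B" "total_recursive s" "total_recursive k"
  shows "decidable (\<lambda>x. meets_boundary (lnth (t x)) (N x) (M x) (L x) (j x) (B x) (s x) (k x))"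
  unfolding meets_boundary_def
  by (intro code_intros assms assms[THEN total_recursive_comp])

definition certifies :: "(nat \<Rightarrow> nat) \<Rightarrow> nat \<Rightarrow> bool" where
  "certifies g e \<longleftrightarrow>
     certificate g (pi1 e) (pi1 (pi2 e)) (pi1 (pi2 (pi2 e))) (pi2 (pi2 (pi2 e)))"

text \<open>An output position \<open>m\<close> codes \<open>(i, B, s, k)\<close>: the list \<open>i\<close> to be written, a candidate basic
  set \<open>B\<close>, a refinement factor \<open>s\<close> of the grid and the length \<open>k\<close> of the input to be consulted.\<close>

definition accepts :: "(nat \<Rightarrow> nat) \<Rightarrow> nat \<Rightarrow> nat \<Rightarrow> bool" where
  "accepts g e m \<longleftrightarrow>
    (if even (pi1 m)
     then misses_piece g (pi1 e) (pi1 (pi2 e)) (pi1 (pi2 (pi2 e))) (pi1 m div 2)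
            (pi1 (pi2 m)) (pi1 (pi2 (pi2 m))) (pi2 (pi2 (pi2 m)))
     else meets_boundary g (pi1 e) (pi1 (pi2 e)) (pi1 (pi2 (pi2 e))) (pi1 m div 2)
            (pi1 (pi2 m)) (pi1 (pi2 (pi2 m))) (pi2 (pi2 (pi2 m))))"

text \<open>Until a certificate with code below the prefix length is valid, the output is the empty
  word, coded by 0. Afterwards the inner quantifier singles out the least valid code, in bounded
  form to stay recursive. A rejected position holds the blank 0, so the word grows with the
  prefix.\<close>

definition machine :: "nat \<Rightarrow> nat" where
  "machine t = (if \<exists>e<llength t. certifies (lnth t) e
     then list_encode (map (\<lambda>m.
       if \<exists>e<llength t. certifies (lnth t) e \<and> (\<forall>e'<e. \<not> certifies (lnth t) e') \<and> accepts (lnth t) e m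
       then Suc (pi1 (pi2 m)) else 0) [0..<llength t])
     else 0)"

lemma decidable_certifies:
  "total_recursive t \<Longrightarrow> total_recursive e \<Longrightarrow> decidable (\<lambda>x. certifies (lnth (t x)) (e x))"
  unfolding certifies_def by (intro recursive_intros decidable_certificate)

lemma decidable_accepts:
  "total_recursive t \<Longrightarrow> total_recursive e \<Longrightarrow> total_recursive m \<Longrightarrow>
   decidable (\<lambda>x. accepts (lnth (t x)) (e x) (m x))"
  unfolding accepts_def by (intro recursive_intros decidable_misses_piece decidable_meets_boundary)

lemma total_recursive_machine: "total_recursive machine"
  unfolding machine_def[abs_def]
  by (intro recursive_intros total_recursive_list_encode_map decidable_certifies decidable_accepts)

section \<open>Dependence on a finite prefix of the input\<close>

lemma listed_before_cong:
  "(\<And>i. i < k \<Longrightarrow> f i = f' i) \<Longrightarrow> listed_before f k = listed_before f' k"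
  by (auto simp: listed_before_def fun_eq_iff)

text \<open>A code bounds its components, so the certificate \<open>e\<close> consults fewer than
  \<open>T\<close> symbols. Validity of a code below the prefix length is therefore the same for the
  prefix and for the whole input.\<close>

lemma certifies_cong:
  assumes "\<And>i. i < T \<Longrightarrow> g i = g' i" "e < T"
  shows "certifies g e = certifies g' e"
proof -
  have "pi2 (pi2 (pi2 e)) < T" using pi_le(2) assms(2) by (meson le_less_trans le_trans)
  then have "listed_before (\<lambda>i. pi1 (g i)) (pi2 (pi2 (pi2 e)))
      = listed_before (\<lambda>i. pi1 (g' i)) (pi2 (pi2 (pi2 e)))"
    "listed_before (\<lambda>i. pi1 (pi2 (g i))) (pi2 (pi2 (pi2 e)))
      = listed_before (\<lambda>i. pi1 (pi2 (g' i))) (pi2 (pi2 (pi2 e)))"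
    using assms(1) by (auto intro!: listed_before_cong)
  \<comment> \<open>The number of components is read off the symbol at 0, which is available because
    \<open>e < T\<close> makes \<open>T\<close> positive.\<close>
  moreover have "g 0 = g' 0" using assms by auto
  ultimately show ?thesis unfolding certifies_def certificate_def by simp
qed

lemma accepts_cong:
  assumes "\<And>i. i < T \<Longrightarrow> g i = g' i" "m < T"
  shows "accepts g e m = accepts g' e m"
proof -
  have "pi2 (pi2 (pi2 m)) < T" using pi_le(2) assms(2) by (meson le_less_trans le_trans)
  then have "listed_before (\<lambda>i. pi1 (g i)) (pi2 (pi2 (pi2 m)))
      = listed_before (\<lambda>i. pi1 (g' i)) (pi2 (pi2 (pi2 m)))"
    "listed_before (\<lambda>i. pi1 (pi2 (g i))) (pi2 (pi2 (pi2 m)))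
      = listed_before (\<lambda>i. pi1 (pi2 (g' i))) (pi2 (pi2 (pi2 m)))"
    using assms(1) by (auto intro!: listed_before_cong)
  then show ?thesis unfolding accepts_def misses_piece_def meets_boundary_def by simp
qed

lemma tte_computes_machine:
  assumes e: "certifies x e" and least: "\<And>e'. e' < e \<Longrightarrow> \<not> certifies x e'"
  shows "tte_computes machine x (\<lambda>m. if accepts x e m then Suc (pi1 (pi2 m)) else 0)"
proof -
  let ?y = "\<lambda>m. if accepts x e m then Suc (pi1 (pi2 m)) else 0"
  have word: "list_decode (machine (prefix_code x k)) = (if e < k then map ?y [0..<k] else [])" for k
  proof -
    define t where "t = prefix_code x k"
    have len: "llength t = k" by (simp add: t_def llength_def prefix_code_def)
    have nth: "lnth t i = x i" if "i < k" for i
      using that by (simp add: t_def lnth_def prefix_code_def)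
    have c: "certifies (lnth t) e' = certifies x e'" if "e' < k" for e'
      using certifies_cong[of k "lnth t" x] nth that by blast
    have a: "accepts (lnth t) e' m = accepts x e' m" if "m < k" for e' m
      using accepts_cong[of k "lnth t" x] nth that by blast
    show ?thesis
    proof (cases "e < k")
      case True
      have "(\<exists>e'<k. certifies (lnth t) e' \<and> (\<forall>e''<e'. \<not> certifies (lnth t) e'') \<and> accepts (lnth t) e' m)
          \<longleftrightarrow> accepts x e m" if "m < k" for m
      proof -
        have "e' = e" if "e' < k" "certifies (lnth t) e'" "\<forall>e''<e'. \<not> certifies (lnth t) e''" for e'
          using that e least c True by (metis linorder_neqE_nat)
        moreover have "\<forall>e'<e. \<not> certifies (lnth t) e'" using c least True by (metis less_trans)
        ultimately show ?thesis using a[OF that] c[OF True] e True by metis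
      qed
      then have "map (\<lambda>m. if \<exists>e'<k. certifies (lnth t) e' \<and> (\<forall>e''<e'. \<not> certifies (lnth t) e'') \<and>
           accepts (lnth t) e' m then Suc (pi1 (pi2 m)) else 0) [0..<k] = map ?y [0..<k]"
        by (intro map_cong) auto
      moreover have "\<exists>e<k. certifies (lnth t) e" using True e c by blast
      ultimately show ?thesis using True unfolding machine_def t_def[symmetric] len by simp
    next
      case False
      then have "\<not> (\<exists>e'<k. certifies (lnth t) e')" using c least by auto
      then have "machine t = 0" unfolding machine_def len by (rule if_not_P)
      then show ?thesis using False by (simp add: t_def)
    qed
  qed
  show ?thesis unfolding tte_computes_def word Let_def
  proof (intro conjI allI)
    fix m show "\<exists>k. m \<le> length (if e < k then map ?y [0..<k] else [])"
      \<comment> \<open>Long enough both to reach the certificate \<open>e\<close> and to write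
        \<open>m\<close> symbols.\<close>
      by (intro exI[of _ "Suc (m + e)"]) simp
  qed simp
qed

section \<open>Passing from the sphere to the plane\<close>

lemma topspace_riemann [simp]: "topspace riemann_topology = UNIV"
proof -
  have "openin riemann_topology UNIV" by (simp add: openin_riemann_topology riemann_open_def)
  then show ?thesis using openin_subset by blast
qed

lemma openin_Some_image: "open T \<Longrightarrow> openin riemann_topology (Some ` T)"
  by (auto simp: openin_riemann_topology riemann_open_def inj_vimage_image_eq)

lemma open_Some_vimage: "openin riemann_topology T \<Longrightarrow> open (Some -` T)"
  by (simp add: openin_riemann_topology riemann_open_def)

text \<open>The open sets around a finite point may be taken planar, since \<open>Some\<close> is
  continuous and open.\<close>

lemma Some_in_closure: "Some z \<in> riemann_topology closure_of S \<longleftrightarrow> z \<in> closure (Some -` S)"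
proof
  assume L: "Some z \<in> riemann_topology closure_of S"
  show "z \<in> closure (Some -` S)"
    unfolding closure_iff_nhds_not_empty
  proof (intro allI impI)
    fix A V assume "V \<subseteq> A" "open V" "z \<in> V"
    then obtain y where "y \<in> S" "y \<in> Some ` V"
      using L openin_Some_image[of V] unfolding in_closure_of by blast
    then show "(Some -` S) \<inter> A \<noteq> {}" using \<open>V \<subseteq> A\<close> by auto
  qed
next
  assume R: "z \<in> closure (Some -` S)"
  show "Some z \<in> riemann_topology closure_of S"
    unfolding in_closure_of
  proof (intro conjI allI impI)
    fix T assume "Some z \<in> T \<and> openin riemann_topology T"
    then have "Some -` S \<inter> Some -` T \<noteq> {}"
      using R open_Some_vimage[of T] unfolding closure_iff_nhds_not_empty by blast
    then show "\<exists>y. y \<in> S \<and> y \<in> T" by auto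
  qed simp
qed

lemma Some_in_frontier:
  "Some z \<in> riemann_topology frontier_of S \<longleftrightarrow> z \<in> frontier (Some -` S)"
  by (simp add: frontier_of_closures frontier_closures Some_in_closure vimage_Compl[symmetric]
      Compl_eq_Diff_UNIV[symmetric])

text \<open>The open set \<open>D\<close> is a neighbourhood of infinity lying on one side of
  \<open>S\<close>, so the frontier of \<open>S\<close> is planar.\<close>

lemma None_notin_frontier:
  assumes "openin riemann_topology D" "None \<in> D" "D \<subseteq> S \<or> D \<inter> S = {}"
  shows "None \<notin> riemann_topology frontier_of S"
proof
  assume "None \<in> riemann_topology frontier_of S"
  then have "D \<inter> riemann_topology frontier_of S \<noteq> {}" using assms(2) by blast
  then show False using frontier_of_openin_straddle_Int[OF assms(1)] assms(3) by blast
qed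

text \<open>As infinity belongs to \<open>U\<close>, it imposes no condition, not even for exteriors
  of disks, whose closures contain it.\<close>

lemma open_name_iff:
  assumes "None \<in> U"
  shows "open_name U p \<longleftrightarrow> listed p = {k. closure (planar_set k) \<inter> - (Some -` U) = {}}"
proof -
  have "riemann_topology closure_of bset k \<subseteq> U \<longleftrightarrow> closure (planar_set k) \<inter> - (Some -` U) = {}" for k
  proof -
    have "planar_set k = Some -` bset k" by (auto simp: planar_set_def)
    then have "riemann_topology closure_of bset k \<subseteq> U \<longleftrightarrow> (\<forall>z\<in>closure (planar_set k). Some z \<in> U)"
      using assms by (simp add: subset_iff split_option_all Some_in_closure Ball_def)
    then show ?thesis by auto
  qed
  then show ?thesis by (simp add: open_name_def)
qed

lemma closed_name_frontier_iff:
  assumes "openin riemann_topology D" "None \<in> D" "D \<subseteq> S \<or> D \<inter> S = {}"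
  shows "closed_name (riemann_topology frontier_of S) q \<longleftrightarrow>
    listed q = {k. planar_set k \<inter> frontier (Some -` S) \<noteq> {}}"
proof -
  have "bset k \<inter> riemann_topology frontier_of S \<noteq> {} \<longleftrightarrow> planar_set k \<inter> frontier (Some -` S) \<noteq> {}" for k
  proof -
    have "(\<exists>x. x \<in> bset k \<and> x \<in> riemann_topology frontier_of S) \<longleftrightarrow>
      (\<exists>z. Some z \<in> bset k \<and> Some z \<in> riemann_topology frontier_of S)"
      using None_notin_frontier[OF assms] by (metis not_Some_eq)
    then show ?thesis by (auto simp: Some_in_frontier planar_set_def)
  qed
  then show ?thesis by (simp add: closed_name_def)
qed

text \<open>The complement of \<open>D\<close> misses infinity, and \<open>Some\<close> embeds the
  plane homeomorphically onto its image, so components correspond.\<close>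

lemma complement_components_image:
  assumes "None \<in> D"
  shows "complement_components D = image Some ` components (- (Some -` D))"
proof -
  define E where "E = - (Some -` D)"
  have "continuous_map euclidean riemann_topology Some"
    by (auto simp: continuous_map_def vimage_def[symmetric] dest: open_Some_vimage)
  moreover have "open_map euclidean riemann_topology Some"
    by (simp add: open_map_def openin_Some_image)
  ultimately have "embedding_map euclidean riemann_topology Some"
    by (intro injective_open_imp_embedding_map) auto
  then have "homeomorphic_map euclidean (subtopology riemann_topology (range Some)) Some"
    by (simp add: embedding_map_def)
  moreover have D: "- D = Some ` E"
    using assms by (auto simp: E_def) (metis ComplI image_eqI not_Some_eq vimageD)
  ultimately have "homeomorphic_map (top_of_set E)
      (subtopology (subtopology riemann_topology (range Some)) (- D)) Some"
    by (intro homeomorphic_map_subtopologies) auto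
  moreover have "range Some \<inter> - D = - D" using D by auto
  ultimately have "homeomorphic_map (top_of_set E) (subtopology riemann_topology (- D)) Some"
    by (simp add: subtopology_subtopology)
  then have "complement_components D = image Some ` connected_components_of (top_of_set E)"
    unfolding complement_components_def by (rule homeomorphic_map_connected_components_of)
  moreover have "connected_components_of (top_of_set E) = components E"
    by (auto simp: connected_components_of_def components_def connected_component_of_def
        connected_component_def connectedin_subtopology intro!: image_cong)
  ultimately show ?thesis by (simp add: E_def)
qed

lemma planar_input_of_domain:
  assumes "openin riemann_topology D" "None \<in> D" "finite (complement_components D)"
    "open_name D p" "closed_name (riemann_topology frontier_of D) q"
  shows "planar_input (- (Some -` D)) p q (card (complement_components D))"
proof
  have "open (Some -` D)" using assms(1) by (rule open_Some_vimage)
  moreover have "bounded (- (Some -` D))"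
  proof -
    obtain r where "\<And>z. r < norm z \<Longrightarrow> Some z \<in> D"
      using assms(1,2) by (auto simp: openin_riemann_topology riemann_open_def)
    then have "- (Some -` D) \<subseteq> cball 0 r" by (auto simp: not_less[symmetric])
    then show ?thesis using bounded_cball bounded_subset by blast
  qed
  ultimately show "compact (- (Some -` D))" by (simp add: compact_eq_bounded_closed closed_Compl)
  have inj: "inj_on (image Some) (components (- (Some -` D)))"
    by (auto intro!: inj_onI simp: inj_image_eq_iff)
  show "finite (components (- (Some -` D)))"
    using assms(3) finite_imageD[OF _ inj] by (simp add: complement_components_image[OF assms(2)])
  show "card (components (- (Some -` D))) = card (complement_components D)"
    by (simp add: complement_components_image[OF assms(2)] card_image[OF inj])
  show "listed p = {k. closure (planar_set k) \<inter> - (Some -` D) = {}}"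
    using assms(2,4) open_name_iff by blast
  show "listed q = {k. planar_set k \<inter> frontier (- (Some -` D)) \<noteq> {}}"
    using assms(1,2,5) closed_name_frontier_iff[of D D q] by (simp add: frontier_complement)
qed

text \<open>Every position codes a full quadruple, so each list is the projection along
  \<open>s\<close> and \<open>k\<close> of a decidable relation: the usual form of a recursively
  enumerable set.\<close>

lemma listed_out_component:
  "listed (out_component (\<lambda>m. if A m then Suc (pi1 (pi2 m)) else 0) i) =
     {B. \<exists>s k. A (prod_encode (i, prod_encode (B, prod_encode (s, k))))}"
proof -
  have "(\<exists>m. A (prod_encode (i, m)) \<and> pi1 m = B) \<longleftrightarrow>
      (\<exists>s k. A (prod_encode (i, prod_encode (B, prod_encode (s, k)))))" for B
    by (metis encode_pi pi_encode(1))
  moreover have "(if A m then Suc b else 0) = Suc B \<longleftrightarrow> A m \<and> b = B" for m b B by simp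
  ultimately show ?thesis by (simp only: listed_def out_component_def pi_encode)
qed

theorem theorem3p2:
  shows "\<exists>h. total_recursive h \<and>
    (\<forall>D p q n.
       sphere_domain D \<and> finite (complement_components D) \<and>
       None \<in> D \<and> Some 0 \<notin> D \<and> n = card (complement_components D) \<and>
       open_name D p \<and> closed_name (riemann_topology frontier_of D) q
     \<longrightarrow> (\<exists>y. tte_computes h (input3 p q n) y \<and>
            (\<exists>K. bij_betw K {..<n} (complement_components D) \<and>
                 (\<forall>j<n. open_name (- K j) (out_component y (2 * j)) \<and>
                        closed_name (riemann_topology frontier_of K j) (out_component y (2 * j + 1))))))"
proof (rule exI[of _ machine], intro conjI total_recursive_machine allI impI)
  fix D p q n
  assume asm: "sphere_domain D \<and> finite (complement_components D) \<and>
       None \<in> D \<and> Some 0 \<notin> D \<and> n = card (complement_components D) \<and>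
       open_name D p \<and> closed_name (riemann_topology frontier_of D) q"
  define E where "E = - (Some -` D)"
  let ?x = "input3 p q n"
  have D: "openin riemann_topology D" "None \<in> D" using asm by (auto simp: sphere_domain_def)
  interpret planar_input E p q n
    using planar_input_of_domain[OF D, of p q] asm by (simp add: E_def)
  obtain N M L k where "certificate ?x N M L k" using certificate_exists by blast
  then have "certifies ?x (prod_encode (N, prod_encode (M, prod_encode (L, k))))"
    by (simp add: certifies_def)
  \<comment> \<open>The labelling depends on the certificate, and thus on the names given; the least
    one is the one on which the machine settles.\<close>
  then obtain e where e: "certifies ?x e" "\<And>e'. e' < e \<Longrightarrow> \<not> certifies ?x e'"
    using exists_least_iff[of "certifies ?x"] by blast
  define F where "F = piece E (pi1 e) (pi1 (pi2 e)) (pi1 (pi2 (pi2 e)))"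
  define y where "y = (\<lambda>m. if accepts ?x e m then Suc (pi1 (pi2 m)) else 0)"
  define K where "K j = Some ` F j" for j
  note cert = e(1)[unfolded certifies_def]
  have "tte_computes machine ?x y" unfolding y_def using e by (rule tte_computes_machine)
  moreover have "bij_betw K {..<n} (complement_components D)"
  proof -
    have "bij_betw F {..<n} (components E)" unfolding F_def by (rule pieces_bij[OF cert])
    moreover have "bij_betw (image Some) (components E) (complement_components D)"
      unfolding complement_components_image[OF D(2)] E_def[symmetric]
      by (auto simp: bij_betw_def intro!: inj_onI simp: inj_image_eq_iff)
    ultimately have "bij_betw (image Some \<circ> F) {..<n} (complement_components D)"
      by (rule bij_betw_trans)
    then show ?thesis by (simp add: K_def[abs_def] comp_def)
  qed
  moreover have "open_name (- K j) (out_component y (2 * j))" if "j < n" for j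
  proof -
    have K: "None \<in> - K j" "- (Some -` (- K j)) = F j" by (auto simp: K_def)
    have "(\<exists>s k. accepts ?x e (prod_encode (2 * j, prod_encode (B, prod_encode (s, k)))))
        \<longleftrightarrow> closure (planar_set B) \<inter> F j = {}" for B
    proof -
      have "accepts ?x e (prod_encode (2 * j, prod_encode (B, prod_encode (s, k)))) \<longleftrightarrow>
          misses_piece ?x (pi1 e) (pi1 (pi2 e)) (pi1 (pi2 (pi2 e))) j B s k" for s k
        by (simp add: accepts_def)
      then show ?thesis
        using misses_piece_sound[OF cert, of j B] misses_piece_complete[OF cert, of B j]
        unfolding F_def by (metis order_refl)
    qed
    then show ?thesis
      unfolding open_name_iff[OF K(1)] K(2) y_def listed_out_component by simp
  qed
  moreover have "closed_name (riemann_topology frontier_of K j) (out_component y (2 * j + 1))"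
    if "j < n" for j
  proof -
    have "D \<inter> K j = {}" using piece_subset[OF cert, of j] by (auto simp: K_def F_def E_def)
    then have *: "D \<subseteq> K j \<or> D \<inter> K j = {}" ..
    have K: "Some -` K j = F j" by (auto simp: K_def)
    have "(\<exists>s k. accepts ?x e (prod_encode (2 * j + 1, prod_encode (B, prod_encode (s, k)))))
        \<longleftrightarrow> planar_set B \<inter> frontier (F j) \<noteq> {}" for B
    proof -
      have "accepts ?x e (prod_encode (2 * j + 1, prod_encode (B, prod_encode (s, k)))) \<longleftrightarrow>
          meets_boundary ?x (pi1 e) (pi1 (pi2 e)) (pi1 (pi2 (pi2 e))) j B s k" for s k
        by (simp add: accepts_def)
      then show ?thesis
        using meets_boundary_sound[OF cert that, of B] meets_boundary_complete[OF cert that, of B]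
        unfolding F_def by (metis order_refl)
    qed
    then show ?thesis
      unfolding closed_name_frontier_iff[OF D *] K y_def listed_out_component by simp
  qed
  ultimately show "\<exists>y. tte_computes machine ?x y \<and>
            (\<exists>K. bij_betw K {..<n} (complement_components D) \<and>
                 (\<forall>j<n. open_name (- K j) (out_component y (2 * j)) \<and>
                        closed_name (riemann_topology frontier_of K j) (out_component y (2 * j + 1))))"
    by (intro exI[of _ y] exI[of _ K] conjI allI impI)
qed

end
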